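(* Let $G$ be a group, $\varphi$ an automorphism of $G$, $H$ a subgroup of $G$ with $\varphi(h)=h$ for all $h\in H$, and let $X=(G,H,\varphi)$ be the associated generalized Alexander quandle. Fix $g\in G$, and let $\psi : C^{R}_{m}(X)_{\mathbb{Z}}\to C_{m}(G/H)$ ($m\ge 0$) be the homomorphisms given by $$\psi(u;Hg_{1},\dots,Hg_{m})=\sum_{\iota\in I_{m}}(-1)^{|\iota|+1}\varphi^{-|\iota|-u}\bigl(g^{-1}H,\,g(\iota,1)^{-1}H,\,g(\iota,2)^{-1}H,\dots,g(\iota,m)^{-1}H\bigr)$$ for $m\ge 2$, $\psi(u;Hg_{1})=-\varphi^{-u}(g^{-1}H,g_{1}^{-1}H)$ for $m=1$, and $\psi(u)=-\varphi^{-u}(g^{-1}H)=-(H)$ for $m=0$. Then $\psi$ is a chain map from $(C^{R}_{\ast}(X)_{\mathbb{Z}},\partial_{\ast})$ to $(C_{\ast}(G/H),\partial_{\ast})$. In particular, $\psi$ induces a chain map $C^{Q}_{m}(X)_{\mathbb{Z}}\to\overline{C}_{m}(G/H)$.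
   Context: Generalized Alexander quandle: $X=(G,H,\varphi)$ is the set $H\backslash G$ of right cosets with the operation $Hg\ast Hk=H\varphi(gk^{-1})k$; this is a quandle. For $x\in X$, $S_{x}:X\to X$ is the bijection $S_{x}(w)=w\ast x$. Quandle chain complexes with the coefficient set $\mathbb{Z}$ (each generator of the associated group of $X$ acts on $\mathbb{Z}$ by $u\mapsto u+1$): $C^{R}_{m}(X)_{\mathbb{Z}}$ is the free $\mathbb{Z}$-module on $\mathbb{Z}\times X^{m}$ for $m\ge 1$, and on $\mathbb{Z}$ for $m=0$; generators are written $(u;x_{1},\dots,x_{m})$. The boundary is $$\partial_{m}(u;x_{1},\dots,x_{m})=\sum_{i=1}^{m}(-1)^{i}(u;x_{1},\dots,\widehat{x_{i}},\dots,x_{m})-\sum_{i=1}^{m}(-1)^{i}(u+1;S_{x_{i}}(x_{1}),\dots,S_{x_{i}}(x_{i-1}),x_{i+1},\dots,x_{m}).$$ For $m\ge 2$, $C^{D}_{m}(X)_{\mathbb{Z}}$ is the submodule generated by the $(u;x_{1},\dots,x_{m})$ with $x_{i}=x_{i+1}$ for some $1\le i\le m-1$; $C^{D}_{0}(X)_{\mathbb{Z}}=C^{D}_{1}(X)_{\mathbb{Z}}=0$. This is a subcomplex and $C^{Q}_{m}(X)_{\mathbb{Z}}=C^{R}_{m}(X)_{\mathbb{Z}}/C^{D}_{m}(X)_{\mathbb{Z}}$. Relative group chain complexes: $G/H$ is the set of left cosets. $G$ acts on $(G/H)^{m+1}$ diagonally by left multiplication, and $\sim$ is the relation of being in the same $G$-orbit.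 $C_{m}(G/H)$ is the free $\mathbb{Z}$-module on $(G/H)^{m+1}/\sim$, with $\partial_{m}(g_{0}H,\dots,g_{m}H)=\sum_{i=0}^{m}(-1)^{i}(g_{0}H,\dots,\widehat{g_{i}H},\dots,g_{m}H)$. For $m\ge 1$, $D_{m}(G/H)$ is the submodule generated by the classes of $(g_{0}H,\dots,g_{m}H)$ with $g_{i}H=g_{i+1}H$ for some $0\le i\le m-1$; $D_{0}(G/H)=0$. This is a subcomplex and $\overline{C}_{m}(G/H)=C_{m}(G/H)/D_{m}(G/H)$. Notation in $\psi$: for $m\ge 2$, $I_{m}$ is the set of maps $\iota:\{2,\dots,m\}\to\{0,1\}$, and $|\iota|$ is the number of $i$ with $\iota(i)=1$. Given $(u;Hg_{1},\dots,Hg_{m})$, $\iota\in I_{m}$ and $1\le i\le m$, the coset $Hg(\iota,i)\in X$ is $$Hg(\iota,i)=S_{Hg_{m}}^{\iota(m)}\circ\cdots\circ S_{Hg_{i+2}}^{\iota(i+2)}\circ S_{Hg_{i+1}}^{\iota(i+1)}(Hg_{i}),$$ and $g(\iota,i)\in G$ is any representative of it (so $g(\iota,i)^{-1}H$ is a well-defined left coset). For $u\in\mathbb{Z}$, $\varphi^{u}(g_{0}H,\dots,g_{m}H)=(\varphi^{u}(g_{0})H,\dots,\varphi^{u}(g_{m})H)$, extended linearly to $C_{m}(G/H)$ and $\overline{C}_{m}(G/H)$. *)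

theory Defs
  imports "HOL-Algebra.Algebra"
begin

text \<open>Conventions: a function on cosets or orbits that is given by a formula in a representative is
  encoded as the union of the values of the formula over all representatives. If the values agree,
  as they do for every function below under the hypotheses of the theorem, the union is the common value.
  Tuples are lists; positions \<open>i\<close> are counted from 1 in quandle chains, where \<open>x\<^sub>i\<close> is \<open>xs ! (i - 1)\<close>,
  and from 0 in group chains, as is customary.\<close>

definition delete_nth :: "nat \<Rightarrow> 'a list \<Rightarrow> 'a list" where
  "delete_nth i xs = take i xs @ drop (Suc i) xs"

subsection \<open>Chain complexes, chain maps, quotients\<close>

text \<open>Complexes are concentrated in degrees \<open>m \<ge> 0\<close>; the map \<open>d m\<close> has source \<open>C m\<close>,
  and the value \<open>d 0\<close> is irrelevant.\<close>

definition chain_complex ::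
  "(nat \<Rightarrow> ('a, 'b) monoid_scheme) \<Rightarrow> (nat \<Rightarrow> 'a \<Rightarrow> 'a) \<Rightarrow> bool" where
  "chain_complex C d \<longleftrightarrow>
     (\<forall>m. comm_group (C m)) \<and>
     (\<forall>m. d (Suc m) \<in> hom (C (Suc m)) (C m)) \<and>
     (\<forall>m. \<forall>c\<in>carrier (C (Suc (Suc m))). d (Suc m) (d (Suc (Suc m)) c) = \<one>\<^bsub>C m\<^esub>)"

definition chain_map ::
  "(nat \<Rightarrow> ('a, 'b) monoid_scheme) \<Rightarrow> (nat \<Rightarrow> 'a \<Rightarrow> 'a) \<Rightarrow>
   (nat \<Rightarrow> ('c, 'd) monoid_scheme) \<Rightarrow> (nat \<Rightarrow> 'c \<Rightarrow> 'c) \<Rightarrow> (nat \<Rightarrow> 'a \<Rightarrow> 'c) \<Rightarrow> bool" where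
  "chain_map C d C' d' f \<longleftrightarrow>
     chain_complex C d \<and> chain_complex C' d' \<and>
     (\<forall>m. f m \<in> hom (C m) (C' m)) \<and>
     (\<forall>m. \<forall>c\<in>carrier (C (Suc m)). f m (d (Suc m) c) = d' (Suc m) (f (Suc m) c))"

text \<open>The map \<open>A Mod M \<rightarrow> B Mod N\<close> induced by \<open>f : A \<rightarrow> B\<close> with \<open>f ` M \<subseteq> N\<close>.\<close>

definition quotient_map ::
  "('c, 'd) monoid_scheme \<Rightarrow> 'c set \<Rightarrow> ('a \<Rightarrow> 'c) \<Rightarrow> 'a set \<Rightarrow> 'c set" where
  "quotient_map B N f K = (\<Union>c\<in>K. N #>\<^bsub>B\<^esub> f c)"

subsection \<open>The generalized Alexander quandle\<close>

text \<open>The operation on the underlying set \<open>rcosets\<^bsub>G\<^esub> H\<close>.\<close>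

definition gaq_op ::
  "('a, 'b) monoid_scheme \<Rightarrow> 'a set \<Rightarrow> ('a \<Rightarrow> 'a) \<Rightarrow> 'a set \<Rightarrow> 'a set \<Rightarrow> 'a set" where
  "gaq_op G H \<phi> A B =
     (\<Union>g\<in>A. \<Union>k\<in>B. H #>\<^bsub>G\<^esub> (\<phi> (g \<otimes>\<^bsub>G\<^esub> inv\<^bsub>G\<^esub> k) \<otimes>\<^bsub>G\<^esub> k))"

definition gaq_S ::
  "('a, 'b) monoid_scheme \<Rightarrow> 'a set \<Rightarrow> ('a \<Rightarrow> 'a) \<Rightarrow> 'a set \<Rightarrow> 'a set \<Rightarrow> 'a set" where
  "gaq_S G H \<phi> x w = gaq_op G H \<phi> w x"

subsection \<open>Quandle chains with coefficient set the integers\<close>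

text \<open>For \<open>m = 0\<close> the generators are the pairs \<open>(u, [])\<close>, i.e. the integers.\<close>

definition rack_gens :: "('a, 'b) monoid_scheme \<Rightarrow> 'a set \<Rightarrow> nat \<Rightarrow> (int \<times> 'a set list) set" where
  "rack_gens G H m = {(u, xs). length xs = m \<and> set xs \<subseteq> rcosets\<^bsub>G\<^esub> H}"

definition rack_chains ::
  "('a, 'b) monoid_scheme \<Rightarrow> 'a set \<Rightarrow> nat \<Rightarrow> ((int \<times> 'a set list) \<Rightarrow>\<^sub>0 int) monoid" where
  "rack_chains G H m = free_Abelian_group (rack_gens G H m)"

definition rack_boundary ::
  "('a, 'b) monoid_scheme \<Rightarrow> 'a set \<Rightarrow> ('a \<Rightarrow> 'a) \<Rightarrow> nat \<Rightarrow>
   ((int \<times> 'a set list) \<Rightarrow>\<^sub>0 int) \<Rightarrow> ((int \<times> 'a set list) \<Rightarrow>\<^sub>0 int)" where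
  "rack_boundary G H \<phi> m = frag_extend (\<lambda>(u, xs).
     (\<Sum>i=1..m. frag_cmul ((-1) ^ i) (frag_of (u, delete_nth (i - 1) xs))) -
     (\<Sum>i=1..m. frag_cmul ((-1) ^ i)
        (frag_of (u + 1, map (gaq_S G H \<phi> (xs ! (i - 1))) (take (i - 1) xs) @ drop i xs))))"

text \<open>The generating set is empty for \<open>m < 2\<close>, and the submodule is then zero.\<close>

definition rack_degenerate ::
  "('a, 'b) monoid_scheme \<Rightarrow> 'a set \<Rightarrow> nat \<Rightarrow> ((int \<times> 'a set list) \<Rightarrow>\<^sub>0 int) set" where
  "rack_degenerate G H m = generate (rack_chains G H m)
     {frag_of (u, xs) | u xs. (u, xs) \<in> rack_gens G H m \<and>
        (\<exists>i. 1 \<le> i \<and> i \<le> m - 1 \<and> xs ! (i - 1) = xs ! i)}"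

definition quandle_chains ::
  "('a, 'b) monoid_scheme \<Rightarrow> 'a set \<Rightarrow> nat \<Rightarrow> ((int \<times> 'a set list) \<Rightarrow>\<^sub>0 int) set monoid" where
  "quandle_chains G H m = rack_chains G H m Mod rack_degenerate G H m"

definition quandle_boundary ::
  "('a, 'b) monoid_scheme \<Rightarrow> 'a set \<Rightarrow> ('a \<Rightarrow> 'a) \<Rightarrow> nat \<Rightarrow>
   ((int \<times> 'a set list) \<Rightarrow>\<^sub>0 int) set \<Rightarrow> ((int \<times> 'a set list) \<Rightarrow>\<^sub>0 int) set" where
  "quandle_boundary G H \<phi> m =
     quotient_map (rack_chains G H (m - 1)) (rack_degenerate G H (m - 1)) (rack_boundary G H \<phi> m)"

subsection \<open>Relative group chains\<close>

definition diag_act :: "('a, 'b) monoid_scheme \<Rightarrow> 'a \<Rightarrow> 'a set list \<Rightarrow> 'a set list" where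
  "diag_act G a ts = map (\<lambda>A. a <#\<^bsub>G\<^esub> A) ts"

definition coset_tuples :: "('a, 'b) monoid_scheme \<Rightarrow> 'a set \<Rightarrow> nat \<Rightarrow> 'a set list set" where
  "coset_tuples G H m = {ts. length ts = Suc m \<and> set ts \<subseteq> lcosets\<^bsub>G\<^esub> H}"

text \<open>The class of a tuple modulo \<open>\<sim>\<close>.\<close>

abbreviation tuple_class :: "('a, 'b) monoid_scheme \<Rightarrow> 'a set list \<Rightarrow> 'a set list set" where
  "tuple_class G ts \<equiv> orbit G (diag_act G) ts"

definition group_chains ::
  "('a, 'b) monoid_scheme \<Rightarrow> 'a set \<Rightarrow> nat \<Rightarrow> ('a set list set \<Rightarrow>\<^sub>0 int) monoid" where
  "group_chains G H m = free_Abelian_group (orbits G (coset_tuples G H m) (diag_act G))"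

definition group_boundary ::
  "('a, 'b) monoid_scheme \<Rightarrow> nat \<Rightarrow> ('a set list set \<Rightarrow>\<^sub>0 int) \<Rightarrow> ('a set list set \<Rightarrow>\<^sub>0 int)" where
  "group_boundary G m = frag_extend (\<lambda>w.
     \<Sum>i=0..m. frag_cmul ((-1) ^ i) (frag_of (\<Union>ts\<in>w. tuple_class G (delete_nth i ts))))"

definition group_degenerate ::
  "('a, 'b) monoid_scheme \<Rightarrow> 'a set \<Rightarrow> nat \<Rightarrow> ('a set list set \<Rightarrow>\<^sub>0 int) set" where
  "group_degenerate G H m = generate (group_chains G H m)
     {frag_of (tuple_class G ts) | ts. ts \<in> coset_tuples G H m \<and> (\<exists>i<m. ts ! i = ts ! Suc i)}"

definition norm_group_chains ::
  "('a, 'b) monoid_scheme \<Rightarrow> 'a set \<Rightarrow> nat \<Rightarrow> ('a set list set \<Rightarrow>\<^sub>0 int) set monoid" where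
  "norm_group_chains G H m = group_chains G H m Mod group_degenerate G H m"

definition norm_group_boundary ::
  "('a, 'b) monoid_scheme \<Rightarrow> 'a set \<Rightarrow> nat \<Rightarrow>
   ('a set list set \<Rightarrow>\<^sub>0 int) set \<Rightarrow> ('a set list set \<Rightarrow>\<^sub>0 int) set" where
  "norm_group_boundary G H m =
     quotient_map (group_chains G H (m - 1)) (group_degenerate G H (m - 1)) (group_boundary G m)"

subsection \<open>The map psi\<close>

text \<open>\<open>\<phi>\<^sup>u\<close> for an integer \<open>u\<close>, acting on a left coset: \<open>xH\<close> is sent to \<open>\<phi>\<^sup>u(x)H\<close>.\<close>

definition aut_pow_lcoset ::
  "('a, 'b) monoid_scheme \<Rightarrow> 'a set \<Rightarrow> ('a \<Rightarrow> 'a) \<Rightarrow> int \<Rightarrow> 'a set \<Rightarrow> 'a set" where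
  "aut_pow_lcoset G H \<phi> u A = (\<Union>x\<in>A. (\<phi> [^]\<^bsub>AutoGroup G\<^esub> u) x <#\<^bsub>G\<^esub> H)"

text \<open>\<open>Hx\<close> is sent to \<open>x\<^sup>-\<^sup>1H\<close>.\<close>

definition inv_coset :: "('a, 'b) monoid_scheme \<Rightarrow> 'a set \<Rightarrow> 'a set \<Rightarrow> 'a set" where
  "inv_coset G H A = (\<Union>x\<in>A. inv\<^bsub>G\<^esub> x <#\<^bsub>G\<^esub> H)"

definition psi_index :: "nat \<Rightarrow> (nat \<Rightarrow> nat) set" where
  "psi_index m = {2..m} \<rightarrow>\<^sub>E {0, 1}"

definition ones :: "nat \<Rightarrow> (nat \<Rightarrow> nat) \<Rightarrow> nat" where
  "ones m \<iota> = card {i \<in> {2..m}. \<iota> i = 1}"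

text \<open>The right coset \<open>Hg(\<iota>,i)\<close>; the list is traversed from the left, so the factor with
  index \<open>i + 1\<close> is applied first and the one with index \<open>m\<close> last.\<close>

definition iter_coset ::
  "('a, 'b) monoid_scheme \<Rightarrow> 'a set \<Rightarrow> ('a \<Rightarrow> 'a) \<Rightarrow> nat \<Rightarrow> 'a set list \<Rightarrow> (nat \<Rightarrow> nat) \<Rightarrow> nat \<Rightarrow> 'a set" where
  "iter_coset G H \<phi> m xs \<iota> i =
     fold (\<lambda>j. gaq_S G H \<phi> (xs ! (j - 1)) ^^ \<iota> j) [Suc i..<Suc m] (xs ! (i - 1))"

text \<open>For \<open>m < 2\<close> the index set has exactly one element, and the formula specializes to
  the separate formulas for \<open>m = 0\<close> and \<open>m = 1\<close>, see the two lemmas below.\<close>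

definition psi_gen ::
  "('a, 'b) monoid_scheme \<Rightarrow> 'a set \<Rightarrow> ('a \<Rightarrow> 'a) \<Rightarrow> 'a \<Rightarrow> nat \<Rightarrow>
   int \<times> 'a set list \<Rightarrow> ('a set list set \<Rightarrow>\<^sub>0 int)" where
  "psi_gen G H \<phi> g m = (\<lambda>(u, xs).
     \<Sum>\<iota>\<in>psi_index m. frag_cmul ((-1) ^ (ones m \<iota> + 1)) (frag_of (tuple_class G
       (map (aut_pow_lcoset G H \<phi> (- int (ones m \<iota>) - u))
          ((inv\<^bsub>G\<^esub> g <#\<^bsub>G\<^esub> H) #
           map (\<lambda>i. inv_coset G H (iter_coset G H \<phi> m xs \<iota> i)) [1..<Suc m])))))"

definition psi ::
  "('a, 'b) monoid_scheme \<Rightarrow> 'a set \<Rightarrow> ('a \<Rightarrow> 'a) \<Rightarrow> 'a \<Rightarrow> nat \<Rightarrow>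
   ((int \<times> 'a set list) \<Rightarrow>\<^sub>0 int) \<Rightarrow> ('a set list set \<Rightarrow>\<^sub>0 int)" where
  "psi G H \<phi> g m = frag_extend (psi_gen G H \<phi> g m)"

lemma psi_0:
  "psi G H \<phi> g 0 (frag_of (u, [])) =
     - frag_of (tuple_class G [aut_pow_lcoset G H \<phi> (- u) (inv\<^bsub>G\<^esub> g <#\<^bsub>G\<^esub> H)])"
  by (simp add: psi_def psi_gen_def psi_index_def ones_def)

lemma psi_1:
  "psi G H \<phi> g 1 (frag_of (u, [A])) =
     - frag_of (tuple_class G
         (map (aut_pow_lcoset G H \<phi> (- u)) [inv\<^bsub>G\<^esub> g <#\<^bsub>G\<^esub> H, inv_coset G H A]))"
  by (simp add: psi_def psi_gen_def psi_index_def ones_def iter_coset_def)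

definition psi_quotient ::
  "('a, 'b) monoid_scheme \<Rightarrow> 'a set \<Rightarrow> ('a \<Rightarrow> 'a) \<Rightarrow> 'a \<Rightarrow> nat \<Rightarrow>
   ((int \<times> 'a set list) \<Rightarrow>\<^sub>0 int) set \<Rightarrow> ('a set list set \<Rightarrow>\<^sub>0 int) set" where
  "psi_quotient G H \<phi> g m =
     quotient_map (group_chains G H m) (group_degenerate G H m) (psi G H \<phi> g m)"

end

theory Submission
  imports Defs
begin

text \<open>Write \<open>x\<^sub>i = Hg\<^sub>i\<close>. Omitting the entry \<open>g(\<iota>,i)\<^sup>-\<^sup>1H\<close> from a term of \<open>\<psi>(u; x\<^sub>1,\<dots>,x\<^sub>m)\<close> forgets \<open>x\<^sub>i\<close>
  except that \<open>S\<close> of \<open>x\<^sub>i\<close> is still applied to the earlier entries when \<open>\<iota>(i) = 1\<close>. By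
  self-distributivity this translation can be pushed inside, so the terms with \<open>\<iota>(i) = 0\<close> give
  \<open>\<psi>\<close> of \<open>(u; x\<^sub>1,\<dots>,x\<^sub>m)\<close> without \<open>x\<^sub>i\<close>, and those with \<open>\<iota>(i) = 1\<close> give minus \<open>\<psi>\<close> of the other
  \<open>i\<close>-th face of the rack boundary; for \<open>i = 1\<close> the value \<open>\<iota>(2)\<close>, which only concerns \<open>x\<^sub>1\<close>, plays
  the role of \<open>\<iota>(i)\<close>. Omitting \<open>g\<^sup>-\<^sup>1H\<close> contributes nothing: \<open>\<iota>(m) = 1\<close> applies the same translation
  to all remaining entries (\<open>x\<^sub>m\<close> is fixed by its own translation), which modulo \<open>G\<close> is \<open>\<phi>\<close> and is
  undone by \<open>\<phi>\<^bsup>-|\<iota>|-u\<^esup>\<close>, so the terms cancel in pairs. Finally \<open>x\<^sub>k = x\<^sub>k\<^sub>+\<^sub>1\<close> forces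
  \<open>g(\<iota>,k)\<^sup>-\<^sup>1H = g(\<iota>,k+1)\<^sup>-\<^sup>1H\<close> by idempotency, so degenerate chains go to degenerate chains.\<close>

subsection \<open>Quotient complexes\<close>

text \<open>Changing the representative by \<open>m\<close> in \<open>M\<close> changes the value by
  \<open>f m\<close>, which lies in \<open>N\<close> and is absorbed. So the union in
  \<open>quotient_map\<close> runs over a constant family, and induced maps can be computed on
  representatives.\<close>

lemma quotient_map_rcos:
  assumes "group A" "group B" "f \<in> hom A B" "subgroup M A" "subgroup N B"
    and "f ` M \<subseteq> N" "a \<in> carrier A"
  shows "quotient_map B N f (M #>\<^bsub>A\<^esub> a) = N #>\<^bsub>B\<^esub> f a"
proof -
  interpret A: group A by fact
  interpret B: group B by fact
  have fa: "f a \<in> carrier B"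
    using assms by (auto simp: hom_def)
  have "N #>\<^bsub>B\<^esub> f (m \<otimes>\<^bsub>A\<^esub> a) = N #>\<^bsub>B\<^esub> f a" if "m \<in> M" for m
  proof -
    have "m \<in> carrier A"
      using assms(4) that by (auto dest: subgroup.mem_carrier)
    moreover have "f m \<in> N"
      using assms(6) that by auto
    moreover have "f m \<in> carrier B"
      using assms(5) \<open>f m \<in> N\<close> by (auto dest: subgroup.mem_carrier)
    ultimately show ?thesis
      using assms fa B.coset_join2[of "f m" N] subgroup.subset[OF assms(5)]
      by (simp add: hom_mult flip: B.coset_mult_assoc)
  qed
  \<comment> \<open>A union over an empty coset would be empty, so the common value needs an element
    to come from.\<close>
  moreover have "M \<noteq> {}"
    using assms(4) subgroup.one_closed by fastforce
  ultimately show ?thesis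
    by (auto simp: quotient_map_def r_coset_def[of A])
qed

lemma rcosets_obtain:
  assumes "K \<in> rcosets\<^bsub>A\<^esub> M"
  obtains a where "a \<in> carrier A" "K = M #>\<^bsub>A\<^esub> a"
  using assms by (auto simp: RCOSETS_def)

lemma quotient_map_hom:
  assumes "comm_group A" "comm_group B" "f \<in> hom A B" "subgroup M A" "subgroup N B"
    and "f ` M \<subseteq> N"
  shows "quotient_map B N f \<in> hom (A Mod M) (B Mod N)"
proof -
  interpret A: comm_group A by fact
  interpret B: comm_group B by fact
  interpret M: normal M A using assms(4) by (rule A.subgroup_imp_normal)
  interpret N: normal N B using assms(5) by (rule B.subgroup_imp_normal)
  note eq = quotient_map_rcos[OF A.is_group B.is_group assms(3-6)]
  show ?thesis
  proof (rule homI)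
    fix K assume "K \<in> carrier (A Mod M)"
    then show "quotient_map B N f K \<in> carrier (B Mod N)"
      using assms(3) by (auto simp: FactGroup_def RCOSETS_def eq hom_def)
  next
    fix K L assume "K \<in> carrier (A Mod M)" "L \<in> carrier (A Mod M)"
    then obtain a b where ab: "a \<in> carrier A" "b \<in> carrier A" "K = M #>\<^bsub>A\<^esub> a" "L = M #>\<^bsub>A\<^esub> b"
      by (auto simp: FactGroup_def RCOSETS_def)
    have "f a \<in> carrier B" "f b \<in> carrier B"
      using ab assms(3) by (auto simp: hom_def)
    with ab show "quotient_map B N f (K \<otimes>\<^bsub>A Mod M\<^esub> L) =
        quotient_map B N f K \<otimes>\<^bsub>B Mod N\<^esub> quotient_map B N f L"
      by (simp add: FactGroup_def M.rcos_sum N.rcos_sum eq hom_mult[OF assms(3)])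
  qed
qed

text \<open>On representatives, \<open>quotient_map_rcos\<close> reduces everything to
  \<open>d\<close>. In degree 0 the index \<open>m - 1\<close> is truncated to 0, which is harmless
  because \<open>chain_complex\<close> only inspects boundaries of degree
  \<open>Suc m\<close>.\<close>

lemma chain_complex_quotient:
  assumes "chain_complex C d" "\<And>m. subgroup (N m) (C m)"
    and "\<And>m. d (Suc m) ` N (Suc m) \<subseteq> N m"
  shows "chain_complex (\<lambda>m. C m Mod N m) (\<lambda>m. quotient_map (C (m - 1)) (N (m - 1)) (d m))"
proof -
  have comm: "comm_group (C m)" and hom: "d (Suc m) \<in> hom (C (Suc m)) (C m)"
    and sq: "c \<in> carrier (C (Suc (Suc m))) \<Longrightarrow> d (Suc m) (d (Suc (Suc m)) c) = \<one>\<^bsub>C m\<^esub>" for m c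
    using assms(1) by (auto simp: chain_complex_def)
  have group: "group (C m)" for m
    using comm by (simp add: comm_group_def)
  note eq = quotient_map_rcos[OF group group hom assms(2) assms(2) assms(3)]
  have "quotient_map (C m) (N m) (d (Suc m))
      (quotient_map (C (Suc m)) (N (Suc m)) (d (Suc (Suc m))) c) = N m"
    if "c \<in> rcosets\<^bsub>C (Suc (Suc m))\<^esub> N (Suc (Suc m))" for m c
  proof -
    obtain a where a: "a \<in> carrier (C (Suc (Suc m)))" "c = N (Suc (Suc m)) #>\<^bsub>C (Suc (Suc m))\<^esub> a"
      using \<open>c \<in> _\<close> by (rule rcosets_obtain)
    have "d (Suc (Suc m)) a \<in> carrier (C (Suc m))"
      using hom a by (auto simp: hom_def)
    then show ?thesis
      using a group.coset_mult_one[OF group subgroup.subset[OF assms(2)]]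
      by (simp add: eq sq)
  qed
  then show ?thesis
    unfolding chain_complex_def
    using comm_group.abelian_FactGroup[OF comm assms(2)]
      quotient_map_hom[OF comm comm hom assms(2) assms(2) assms(3)]
    by (auto simp: FactGroup_def)
qed

lemma chain_map_quotient:
  assumes "chain_map C d C' d' f" "\<And>m. subgroup (N m) (C m)" "\<And>m. subgroup (N' m) (C' m)"
    and "\<And>m. d (Suc m) ` N (Suc m) \<subseteq> N m" "\<And>m. d' (Suc m) ` N' (Suc m) \<subseteq> N' m"
    and "\<And>m. f m ` N m \<subseteq> N' m"
  shows "chain_map (\<lambda>m. C m Mod N m) (\<lambda>m. quotient_map (C (m - 1)) (N (m - 1)) (d m))
           (\<lambda>m. C' m Mod N' m) (\<lambda>m. quotient_map (C' (m - 1)) (N' (m - 1)) (d' m))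
           (\<lambda>m. quotient_map (C' m) (N' m) (f m))"
proof -
  have cc: "chain_complex C d" and cc': "chain_complex C' d'" and fhom: "f m \<in> hom (C m) (C' m)"
    and comm: "c \<in> carrier (C (Suc m)) \<Longrightarrow> f m (d (Suc m) c) = d' (Suc m) (f (Suc m) c)" for m c
    using assms(1) by (auto simp: chain_map_def)
  have cg: "comm_group (C m)" "comm_group (C' m)"
    and hom: "d (Suc m) \<in> hom (C (Suc m)) (C m)" "d' (Suc m) \<in> hom (C' (Suc m)) (C' m)" for m
    using cc cc' by (auto simp: chain_complex_def)
  have group: "group (C m)" "group (C' m)" for m
    using cg by (auto simp: comm_group_def)
  note eqs = quotient_map_rcos[OF group(1) group(1) hom(1) assms(2) assms(2) assms(4)]
    quotient_map_rcos[OF group(2) group(2) hom(2) assms(3) assms(3) assms(5)]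
    quotient_map_rcos[OF group(1) group(2) fhom assms(2) assms(3) assms(6)]
  have "quotient_map (C' m) (N' m) (f m) (quotient_map (C m) (N m) (d (Suc m)) c) =
      quotient_map (C' m) (N' m) (d' (Suc m)) (quotient_map (C' (Suc m)) (N' (Suc m)) (f (Suc m)) c)"
    if "c \<in> rcosets\<^bsub>C (Suc m)\<^esub> N (Suc m)" for m c
  proof -
    obtain a where a: "a \<in> carrier (C (Suc m))" "c = N (Suc m) #>\<^bsub>C (Suc m)\<^esub> a"
      using \<open>c \<in> _\<close> by (rule rcosets_obtain)
    have "d (Suc m) a \<in> carrier (C m)" "f (Suc m) a \<in> carrier (C' (Suc m))"
      using hom fhom a by (auto simp: hom_def Pi_def)
    then show ?thesis
      using a by (simp add: eqs comm)
  qed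
  then show ?thesis
    unfolding chain_map_def
    using chain_complex_quotient[OF cc assms(2,4)] chain_complex_quotient[OF cc' assms(3,5)]
      quotient_map_hom[OF cg fhom assms(2,3,6)]
    by (auto simp: FactGroup_def)
qed

subsection \<open>Complexes of free abelian groups\<close>

lemma frag_extend_hom:
  assumes "\<And>x. x \<in> S \<Longrightarrow> F x \<in> carrier (free_Abelian_group T)"
  shows "frag_extend F \<in> hom (free_Abelian_group S) (free_Abelian_group T)"
proof (rule homI)
  fix c assume "c \<in> carrier (free_Abelian_group S)"
  then show "frag_extend F c \<in> carrier (free_Abelian_group T)"
    using assms keys_frag_extend[of F c] by fastforce
qed (simp add: frag_extend_add)

text \<open>Both composites are additive, so \<open>frag_induction\<close> leaves only the
  generators to check.\<close>

lemma chain_complex_free: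
  assumes "\<And>m x. x \<in> S (Suc m) \<Longrightarrow> F (Suc m) x \<in> carrier (free_Abelian_group (S m))"
    and "\<And>m x. x \<in> S (Suc (Suc m)) \<Longrightarrow> frag_extend (F (Suc m)) (F (Suc (Suc m)) x) = 0"
  shows "chain_complex (\<lambda>m. free_Abelian_group (S m)) (\<lambda>m. frag_extend (F m))"
proof -
  have "frag_extend (F (Suc m)) (frag_extend (F (Suc (Suc m))) c) = 0"
    if "Poly_Mapping.keys c \<subseteq> S (Suc (Suc m))" for m c
    using that by (induction c rule: frag_induction) (auto simp: assms(2) frag_extend_diff)
  then show ?thesis
    unfolding chain_complex_def
    by (simp add: abelian_free_Abelian_group frag_extend_hom[OF assms(1)])
qed

lemma chain_map_free:
  assumes "chain_complex (\<lambda>m. free_Abelian_group (S m)) (\<lambda>m. frag_extend (F m))"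
    and "chain_complex (\<lambda>m. free_Abelian_group (T m)) (\<lambda>m. frag_extend (E m))"
    and "\<And>m x. x \<in> S m \<Longrightarrow> P m x \<in> carrier (free_Abelian_group (T m))"
    and "\<And>m x. x \<in> S (Suc m) \<Longrightarrow>
      frag_extend (P m) (F (Suc m) x) = frag_extend (E (Suc m)) (P (Suc m) x)"
  shows "chain_map (\<lambda>m. free_Abelian_group (S m)) (\<lambda>m. frag_extend (F m))
    (\<lambda>m. free_Abelian_group (T m)) (\<lambda>m. frag_extend (E m)) (\<lambda>m. frag_extend (P m))"
proof -
  have "frag_extend (P m) (frag_extend (F (Suc m)) c) =
      frag_extend (E (Suc m)) (frag_extend (P (Suc m)) c)"
    if "Poly_Mapping.keys c \<subseteq> S (Suc m)" for m c
    using that by (induction c rule: frag_induction) (auto simp: assms(4) frag_extend_diff)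
  then show ?thesis
    unfolding chain_map_def
    using assms(1,2) frag_extend_hom[OF assms(3)] by auto
qed

text \<open>A homomorphism sends a generated subgroup to the one generated by the images. This
  handles degenerate chains under both boundaries and under \<open>psi\<close>.\<close>

lemma frag_extend_image_generate:
  assumes "\<And>x. x \<in> S \<Longrightarrow> F x \<in> carrier (free_Abelian_group T)"
    and "K \<subseteq> carrier (free_Abelian_group S)" "subgroup N (free_Abelian_group T)"
    and "\<And>c. c \<in> K \<Longrightarrow> frag_extend F c \<in> N"
  shows "frag_extend F ` generate (free_Abelian_group S) K \<subseteq> N"
proof -
  interpret group_hom "free_Abelian_group S" "free_Abelian_group T" "frag_extend F"
    using frag_extend_hom[OF assms(1)]
    by (intro group_hom.intro group_hom_axioms.intro group_free_Abelian_group)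
  show ?thesis
    using assms(2-4) H.generate_subgroup_incl[of "frag_extend F ` K" N]
    by (auto simp flip: generate_img)
qed

text \<open>Used to split a boundary into its faces: \<open>frag_extend\<close> is linear in the
  function as well as in the chain.\<close>

lemma frag_extend_sum_left:
  "frag_extend (\<lambda>x. \<Sum>i\<in>I. F i x) c = (\<Sum>i\<in>I. frag_extend (F i) c)"
proof -
  \<comment> \<open>\<open>frag_induction\<close> asks for a bound on the support;
    \<open>UNIV\<close> bounds that of every chain.\<close>
  have "Poly_Mapping.keys c \<subseteq> UNIV" by simp
  then show ?thesis
    by (induction c rule: frag_induction) (auto simp: frag_extend_diff sum_subtractf)
qed

lemma frag_extend_cmul_left:
  "frag_extend (\<lambda>x. frag_cmul k (F x)) c = frag_cmul k (frag_extend F c)"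
  by (simp add: frag_extend_def frag_cmul_sum mult.commute)

lemma frag_cmul_uminus: "frag_cmul k (- c) = - frag_cmul k c"
  using frag_cmul_cmul[of k "-1" c] by simp

lemma frag_cmul_diff: "frag_cmul k (a - b) = frag_cmul k a - frag_cmul k b"
  using frag_cmul_distrib2[of k "a - b" b] by (simp add: algebra_simps)

lemma cmul_carrier_free:
  "c \<in> carrier (free_Abelian_group T) \<Longrightarrow> frag_cmul k c \<in> carrier (free_Abelian_group T)"
  using keys_cmul by fastforce

section \<open>Subgroups of a free abelian group\<close>

context
  fixes S :: "'c set" and N
  assumes N: "subgroup N (free_Abelian_group S)"
begin

lemma free_subgroup_zero: "0 \<in> N"
  using subgroup.one_closed[OF N] by simp

lemma free_subgroup_add: "c \<in> N \<Longrightarrow> e \<in> N \<Longrightarrow> c + e \<in> N"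
  using subgroup.m_closed[OF N] by simp

lemma free_subgroup_uminus: "c \<in> N \<Longrightarrow> - c \<in> N"
  using subgroup.m_inv_closed[OF N, of c] subgroup.mem_carrier[OF N, of c] by simp

lemma free_subgroup_diff: "c \<in> N \<Longrightarrow> e \<in> N \<Longrightarrow> c - e \<in> N"
  using free_subgroup_add[of c "- e"] free_subgroup_uminus by simp

lemma free_subgroup_cmul: "c \<in> N \<Longrightarrow> frag_cmul k c \<in> N"
  by (rule frag_closure_minus_cmul[where P = "\<lambda>c. c \<in> N"])
    (auto intro: free_subgroup_zero free_subgroup_diff)

lemma free_subgroup_sum: "(\<And>i. i \<in> I \<Longrightarrow> c i \<in> N) \<Longrightarrow> sum c I \<in> N"
  by (induction I rule: infinite_finite_induct) (auto intro: free_subgroup_zero free_subgroup_add)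

text \<open>Equal neighbouring faces carry opposite signs and cancel; the rest lies in
  \<open>N\<close> term by term. This is how both boundaries preserve degenerate chains.\<close>

lemma alternating_sum_degenerate:
  assumes "Suc k < n" "E k = E (Suc k)"
    and "\<And>i. i < n \<Longrightarrow> i \<noteq> k \<Longrightarrow> i \<noteq> Suc k \<Longrightarrow> E i \<in> N"
  shows "(\<Sum>i<n. frag_cmul ((-1) ^ i) (E i)) \<in> N"
proof -
  have "(\<Sum>i<n. frag_cmul ((-1) ^ i) (E i)) =
      (\<Sum>i\<in>{k, Suc k}. frag_cmul ((-1) ^ i) (E i)) +
      (\<Sum>i\<in>{..<n} - {k, Suc k}. frag_cmul ((-1) ^ i) (E i))"
    using assms(1) by (subst sum.subset_diff[of "{k, Suc k}"]) (auto simp: add.commute)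
  also have "(\<Sum>i\<in>{k, Suc k}. frag_cmul ((-1) ^ i) (E i)) = 0"
    using assms(2) by (simp flip: frag_cmul_distrib)
  finally show ?thesis
    using assms(3) by (auto intro!: free_subgroup_sum free_subgroup_cmul)
qed

end

text \<open>The pair \<open>(j, i)\<close> with \<open>i < j\<close> is matched with
  \<open>(i, j - 1)\<close>: the terms agree by assumption, while the index sum drops by one and
  flips the sign.\<close>

lemma alternating_double_sum:
  fixes A :: "nat \<Rightarrow> nat \<Rightarrow> 'c \<Rightarrow>\<^sub>0 int"
  assumes "\<And>i j. i < j \<Longrightarrow> j \<le> n \<Longrightarrow> A i j = A (j - 1) i"
  shows "(\<Sum>j<Suc n. \<Sum>i<n. frag_cmul ((-1) ^ (i + j)) (A i j)) = 0"
proof -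
  let ?f = "\<lambda>(j, i). frag_cmul ((-1) ^ (i + j)) (A i j)"
  let ?U = "{(j, i). i < j \<and> j \<le> n}" and ?L = "{(j, i). j \<le> i \<and> i < n}"
  have sub: "?U \<subseteq> {..n} \<times> {..n}" "?L \<subseteq> {..n} \<times> {..n}"
    by auto
  have fin: "finite ?U" "finite ?L"
    using sub finite_subset by (blast intro: finite_cartesian_product)+
  have "(\<Sum>j<Suc n. \<Sum>i<n. frag_cmul ((-1) ^ (i + j)) (A i j)) = sum ?f ({..<Suc n} \<times> {..<n})"
    by (simp add: sum.cartesian_product)
  also have "{..<Suc n} \<times> {..<n} = ?U \<union> ?L"
    by auto
  also have "sum ?f (?U \<union> ?L) = sum ?f ?U + sum ?f ?L"
    by (rule sum.union_disjoint[OF fin]) auto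
  also have "sum ?f ?U = (\<Sum>p\<in>?L. - ?f p)"
  proof (rule sum.reindex_bij_witness[where i = "\<lambda>(j, i). (Suc i, j)" and j = "\<lambda>(j, i). (i, j - 1)"])
    fix p assume "p \<in> ?U"
    then obtain i j where ij: "p = (Suc j, i)" "i \<le> j" "j < n"
      by (cases p; cases "fst p") auto
    then show "- ?f (case p of (j, i) \<Rightarrow> (i, j - 1)) = ?f p"
      using assms[of i "Suc j"] by (simp add: add.commute)
  qed auto
  finally show ?thesis
    by (simp add: sum_negf)
qed

text \<open>\<open>E j\<close> stands for the \<open>j\<close>-th face of a fixed generator and
  \<open>D i\<close> for the face maps one degree lower. The assumption is the presimplicial
  identity, which both complexes satisfy.\<close>

lemma alternating_faces_square:
  assumes "\<And>i j. i < j \<Longrightarrow> j \<le> n \<Longrightarrow> frag_extend (D i) (E j) = frag_extend (D (j - 1)) (E i)"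
  shows "frag_extend (\<lambda>x. \<Sum>i<n. frag_cmul ((-1) ^ i) (D i x))
    (\<Sum>j<Suc n. frag_cmul ((-1) ^ j) (E j)) = 0"
proof -
  have "frag_extend (\<lambda>x. \<Sum>i<n. frag_cmul ((-1) ^ i) (D i x))
      (\<Sum>j<Suc n. frag_cmul ((-1) ^ j) (E j)) =
    (\<Sum>j<Suc n. \<Sum>i<n. frag_cmul ((-1) ^ (i + j)) (frag_extend (D i) (E j)))"
    unfolding frag_extend_sum[OF finite_lessThan] o_def frag_extend_cmul frag_extend_sum_left
      frag_extend_cmul_left frag_cmul_sum frag_cmul_cmul
    by (subst sum.swap) (simp only: power_add)
  then show ?thesis
    using alternating_double_sum[of n "\<lambda>i j. frag_extend (D i) (E j)"] assms by simp
qed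

subsection \<open>Coset formulas\<close>

lemma delete_nth_map: "delete_nth i (map f xs) = map f (delete_nth i xs)"
  by (simp add: delete_nth_def take_map drop_map)

lemma set_delete_nth: "set (delete_nth i xs) \<subseteq> set xs"
  unfolding delete_nth_def using set_take_subset[of i xs] set_drop_subset[of "Suc i" xs] by auto

lemma length_delete_nth: "i < length xs \<Longrightarrow> length (delete_nth i xs) = length xs - 1"
  by (simp add: delete_nth_def)

lemma nth_delete_nth:
  "k < length xs - 1 \<Longrightarrow> delete_nth i xs ! k = xs ! (if k < i then k else Suc k)"
  by (auto simp: delete_nth_def nth_append min_def)

lemma delete_nth_delete_nth:
  assumes "i < j" "j < length xs"
  shows "delete_nth i (delete_nth j xs) = delete_nth (j - 1) (delete_nth i xs)"
  using assms by (intro nth_equalityI) (auto simp: length_delete_nth nth_delete_nth)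

section \<open>The quandle operation in coset representatives\<close>

locale alexander_quandle = group G for G (structure) +
  fixes H \<phi>
  assumes aut: "\<phi> \<in> auto G"
    and sub: "subgroup H G"
    and phi_fix: "h \<in> H \<Longrightarrow> \<phi> h = h"
begin

abbreviation "S \<equiv> gaq_S G H \<phi>"
abbreviation "Q \<equiv> rcosets H"
abbreviation "cls \<equiv> tuple_class G"
abbreviation "aut_pow u \<equiv> \<phi> [^]\<^bsub>AutoGroup G\<^esub> (u::int)"

lemma H_carrier: "h \<in> H \<Longrightarrow> h \<in> carrier G"
  using sub by (rule subgroup.mem_carrier)

lemma auto_closed: "f \<in> auto G \<Longrightarrow> x \<in> carrier G \<Longrightarrow> f x \<in> carrier G"
  and auto_mult: "f \<in> auto G \<Longrightarrow> x \<in> carrier G \<Longrightarrow> y \<in> carrier G \<Longrightarrow> f (x \<otimes> y) = f x \<otimes> f y"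
  by (auto simp: auto_def hom_def)

lemma auto_inv: "f \<in> auto G \<Longrightarrow> x \<in> carrier G \<Longrightarrow> f (inv x) = inv (f x)"
  using group_hom.hom_inv[of G G f x] is_group
  by (auto simp: auto_def group_hom_def group_hom_axioms_def)

lemmas phi_closed [simp] = auto_closed[OF aut]
lemmas phi_mult = auto_mult[OF aut]
lemmas phi_inv = auto_inv[OF aut]

lemma carrier_AutoGroup: "carrier (AutoGroup G) = auto G"
  by (simp add: AutoGroup_def)

lemma mult_AutoGroup:
  "f \<in> auto G \<Longrightarrow> f' \<in> auto G \<Longrightarrow> x \<in> carrier G \<Longrightarrow> (f \<otimes>\<^bsub>AutoGroup G\<^esub> f') x = f (f' x)"
  by (auto simp: AutoGroup_def BijGroup_def auto_def compose_def)

lemma one_AutoGroup: "x \<in> carrier G \<Longrightarrow> \<one>\<^bsub>AutoGroup G\<^esub> x = x"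
  by (simp add: AutoGroup_def BijGroup_def)

lemma aut_pow_auto: "aut_pow u \<in> auto G"
  using group.int_pow_closed[OF AutoGroup, of \<phi> u] aut by (simp add: carrier_AutoGroup)

lemmas aut_pow_closed [simp] = auto_closed[OF aut_pow_auto]
lemmas aut_pow_mult = auto_mult[OF aut_pow_auto]

text \<open>The rule by which one application of \<open>\<phi>\<close> is traded for one unit of the
  exponent, also for negative exponents.\<close>

lemma aut_pow_phi: "x \<in> carrier G \<Longrightarrow> aut_pow (u - 1) (\<phi> x) = aut_pow u x"
  using group.int_pow_mult[OF AutoGroup, of \<phi> "u - 1" 1] group.int_pow_1[OF AutoGroup, of \<phi>]
    mult_AutoGroup[OF aut_pow_auto aut] aut
  by (simp add: carrier_AutoGroup)

lemma aut_pow_fix: "h \<in> H \<Longrightarrow> aut_pow u h = h"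
proof (induction u rule: int_induct[where k = 0])
  case base
  then show ?case by (simp add: one_AutoGroup H_carrier)
next
  case (step1 i)
  then show ?case using aut_pow_phi[of h "i + 1"] by (simp add: H_carrier phi_fix)
next
  case (step2 i)
  then show ?case using aut_pow_phi[of h i] by (simp add: H_carrier phi_fix)
qed

lemma rcos_absorb: "h \<in> H \<Longrightarrow> x \<in> carrier G \<Longrightarrow> H #> (h \<otimes> x) = H #> x"
  using coset_join2[of h H] sub subgroup.subset[OF sub]
  by (simp add: H_carrier flip: coset_mult_assoc)

lemma lcos_absorb: "h \<in> H \<Longrightarrow> x \<in> carrier G \<Longrightarrow> (x \<otimes> h) <# H = x <# H"
  by (rule l_repr_independence[symmetric, OF _ _ sub]) (auto simp: l_coset_def)

lemma mem_rcos_self: "x \<in> carrier G \<Longrightarrow> x \<in> H #> x"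
  using rcos_self sub by blast

text \<open>Replacing \<open>x\<close> by \<open>h1 \<otimes> x\<close> and \<open>k\<close> by
  \<open>h2 \<otimes> k\<close> only multiplies the result by \<open>h1\<close> on the left: the
  inverse of \<open>h2\<close> is fixed by \<open>\<phi>\<close> and cancels against the
  \<open>h2\<close> in front of \<open>k\<close>.\<close>

lemma gaq_S_rcos:
  assumes "k \<in> carrier G" "x \<in> carrier G"
  shows "S (H #> k) (H #> x) = H #> (\<phi> (x \<otimes> inv k) \<otimes> k)"
proof -
  have "H #> (\<phi> (x' \<otimes> inv k') \<otimes> k') = H #> (\<phi> (x \<otimes> inv k) \<otimes> k)"
    if x': "x' \<in> H #> x" and k': "k' \<in> H #> k" for x' k'
  proof -
    obtain h1 h2 where h: "h1 \<in> H" "h2 \<in> H" "x' = h1 \<otimes> x" "k' = h2 \<otimes> k"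
      using x' k' by (auto simp: r_coset_def)
    then have hc: "h1 \<in> carrier G" "h2 \<in> carrier G"
      by (auto intro: H_carrier)
    have "\<phi> (x' \<otimes> inv k') \<otimes> k' = h1 \<otimes> (\<phi> (x \<otimes> inv k) \<otimes> k)"
      using assms hc h(1,2)
      by (simp add: h(3,4) inv_mult_group phi_mult phi_inv phi_fix m_assoc)
        (simp add: phi_fix hc flip: m_assoc)
    then show ?thesis
      using assms h by (simp add: rcos_absorb)
  qed
  then show ?thesis
    unfolding gaq_S_def gaq_op_def
    using mem_rcos_self[OF assms(1)] mem_rcos_self[OF assms(2)]
    by (intro SUP_eq_const) blast+
qed

lemma inv_coset_rcos: "x \<in> carrier G \<Longrightarrow> inv_coset G H (H #> x) = inv x <# H"
  using subgroup.m_inv_closed[OF sub] subgroup.one_closed[OF sub]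
  by (auto simp: inv_coset_def r_coset_def inv_mult_group H_carrier lcos_absorb)

text \<open>Well-definedness: powers of \<open>\<phi>\<close> fix \<open>H\<close>, so a factor from
  \<open>H\<close> stays on the right and is absorbed.\<close>

lemma aut_pow_lcos: "x \<in> carrier G \<Longrightarrow> aut_pow_lcoset G H \<phi> u (x <# H) = aut_pow u x <# H"
  using subgroup.one_closed[OF sub]
  by (auto simp: aut_pow_lcoset_def l_coset_def[of G x] aut_pow_mult aut_pow_fix H_carrier lcos_absorb)

lemma rcosetE:
  assumes "A \<in> Q"
  obtains x where "x \<in> carrier G" "A = H #> x"
  using assms by (auto simp: RCOSETS_def)

lemma rcos_in_rcosets: "x \<in> carrier G \<Longrightarrow> H #> x \<in> Q"
  using subgroup.subset[OF sub] by (rule rcosetsI)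

lemma lcos_in_lcosets: "x \<in> carrier G \<Longrightarrow> x <# H \<in> lcosets H"
  by (auto simp: LCOSETS_def)

lemma lcosetE:
  assumes "A \<in> lcosets H"
  obtains x where "x \<in> carrier G" "A = x <# H"
  using assms by (auto simp: LCOSETS_def)

lemma gaq_S_closed: "A \<in> Q \<Longrightarrow> B \<in> Q \<Longrightarrow> S A B \<in> Q"
  by (elim rcosetE) (simp add: gaq_S_rcos rcos_in_rcosets)

lemma gaq_S_idem: "A \<in> Q \<Longrightarrow> S A A = A"
  using one_closed aut phi_fix[OF subgroup.one_closed[OF sub]] by (elim rcosetE) (simp add: gaq_S_rcos)

text \<open>On representatives both sides become \<open>\<phi> (\<phi> (c \<otimes> inv b))
  \<otimes> \<phi> (b \<otimes> inv a) \<otimes> a\<close>.\<close>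

lemma gaq_S_distrib:
  assumes "A \<in> Q" "B \<in> Q" "C \<in> Q"
  shows "S A (S B C) = S (S A B) (S A C)"
proof -
  obtain a b c where abc: "a \<in> carrier G" "b \<in> carrier G" "c \<in> carrier G"
    and eq: "A = H #> a" "B = H #> b" "C = H #> c"
    using assms by (metis rcosetE)
  \<comment> \<open>Cancellation in right-nested form, as \<open>m_assoc\<close> leaves the
    words.\<close>
  have cancel: "inv x \<otimes> (x \<otimes> y) = y" "x \<otimes> (inv x \<otimes> y) = y"
    if "x \<in> carrier G" "y \<in> carrier G" for x y
    using that by (simp_all flip: m_assoc)
  show ?thesis
    using abc by (simp add: eq gaq_S_rcos phi_mult phi_inv inv_mult_group m_assoc cancel)
qed

lemma gaq_S_pow_closed: "A \<in> Q \<Longrightarrow> B \<in> Q \<Longrightarrow> (S A ^^ n) B \<in> Q"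
  by (induction n) (auto intro: gaq_S_closed)

lemma gaq_S_pow_idem: "A \<in> Q \<Longrightarrow> (S A ^^ n) A = A"
  by (induction n) (auto simp: gaq_S_idem)

text \<open>Each power of \<open>S A\<close> is an endomorphism of the quandle, by induction on
  \<open>n\<close>; induction on \<open>k\<close> then carries it past a power of
  \<open>S B\<close>. The exponents will be the bits of \<open>\<iota>\<close>.\<close>

lemma gaq_S_pow_distrib:
  assumes "A \<in> Q" "B \<in> Q" "C \<in> Q"
  shows "(S A ^^ n) ((S B ^^ k) C) = (S ((S A ^^ n) B) ^^ k) ((S A ^^ n) C)"
proof -
  have *: "(S A ^^ n) (S B D) = S ((S A ^^ n) B) ((S A ^^ n) D)" if "D \<in> Q" for D
    using assms that by (induction n) (simp_all add: gaq_S_distrib gaq_S_pow_closed)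
  show ?thesis
    using assms by (induction k) (simp_all add: * gaq_S_pow_closed)
qed

subsection \<open>Relative group chains\<close>

lemma diag_act_diag_act:
  assumes "a \<in> carrier G" "b \<in> carrier G" "set ts \<subseteq> lcosets H"
  shows "diag_act G b (diag_act G a ts) = diag_act G (b \<otimes> a) ts"
  using assms subgroup.lcosets_carrier[OF sub is_group] by (auto simp: diag_act_def lcos_m_assoc)

lemma tuple_class_diag_act:
  assumes a: "a \<in> carrier G" and ts: "set ts \<subseteq> lcosets H"
  shows "cls (diag_act G a ts) = cls ts"
proof -
  \<comment> \<open>Acting by \<open>b \<otimes> inv a\<close> leads from the translate by
    \<open>a\<close> to the translate by \<open>b\<close>.\<close>
  have "diag_act G b ts \<in> cls (diag_act G a ts)" if b: "b \<in> carrier G" for b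
    using diag_act_diag_act[OF a _ ts, of "b \<otimes> inv a"] a b
    by (auto simp: orbit_def m_assoc intro!: exI[of _ "b \<otimes> inv a"])
  then show ?thesis
    using a ts by (auto simp: orbit_def diag_act_diag_act)
qed

lemma tuple_class_self: "set ts \<subseteq> lcosets H \<Longrightarrow> ts \<in> cls ts"
  using subgroup.lcosets_carrier[OF sub is_group]
  by (auto simp: orbit_def diag_act_def lcos_mult_one intro!: exI[of _ \<one>] map_idI[symmetric])

text \<open>A single unsigned summand of the boundary, isolated so that the lemmas on alternating
  sums apply.\<close>

definition group_face :: "nat \<Rightarrow> 'a set list set \<Rightarrow> 'a set list set \<Rightarrow>\<^sub>0 int" where
  "group_face i w = frag_of (\<Union>ts\<in>w. cls (delete_nth i ts))"

text \<open>Deleting an entry commutes with the diagonal action, so all tuples of an orbit give the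
  same class.\<close>

lemma group_face_cls:
  assumes "set ts \<subseteq> lcosets H"
  shows "group_face i (cls ts) = frag_of (cls (delete_nth i ts))"
proof -
  have "cls (delete_nth i us) = cls (delete_nth i ts)" if us: "us \<in> cls ts" for us
  proof -
    obtain a where "a \<in> carrier G" "us = diag_act G a ts"
      using us by (auto simp: orbit_def)
    moreover have "delete_nth i (diag_act G a ts) = diag_act G a (delete_nth i ts)"
      by (simp add: diag_act_def delete_nth_map)
    ultimately show ?thesis
      using assms set_delete_nth[of i ts] by (simp add: tuple_class_diag_act)
  qed
  then have "(\<Union>us\<in>cls ts. cls (delete_nth i us)) = cls (delete_nth i ts)"
    using tuple_class_self[OF assms] by (intro SUP_eq_const) blast+
  then show ?thesis
    by (simp add: group_face_def)
qed

lemma group_boundary_eq: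
  "group_boundary G m = frag_extend (\<lambda>w. \<Sum>i<Suc m. frag_cmul ((-1) ^ i) (group_face i w))"
  by (simp only: group_boundary_def group_face_def atLeast0AtMost lessThan_Suc_atMost)

lemma delete_nth_coset_tuples:
  "ts \<in> coset_tuples G H (Suc m) \<Longrightarrow> i < Suc (Suc m) \<Longrightarrow> delete_nth i ts \<in> coset_tuples G H m"
  using set_delete_nth[of i ts] by (auto simp: coset_tuples_def length_delete_nth)

lemma coset_tuples_subset: "ts \<in> coset_tuples G H m \<Longrightarrow> set ts \<subseteq> lcosets H"
  by (simp add: coset_tuples_def)

lemma frag_of_cls_carrier: "ts \<in> coset_tuples G H m \<Longrightarrow> frag_of (cls ts) \<in> carrier (group_chains G H m)"
  by (auto simp: group_chains_def orbits_def)

lemma group_boundary_closed: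
  assumes "w \<in> orbits G (coset_tuples G H (Suc m)) (diag_act G)"
  shows "(\<Sum>i<Suc (Suc m). frag_cmul ((-1) ^ i) (group_face i w)) \<in> carrier (group_chains G H m)"
proof -
  obtain ts where ts: "ts \<in> coset_tuples G H (Suc m)" "w = cls ts"
    using assms by (auto simp: orbits_def)
  then show ?thesis
    unfolding group_chains_def
    using frag_of_cls_carrier[OF delete_nth_coset_tuples[OF ts(1)]]
    by (intro sum_closed_free_Abelian_group cmul_carrier_free)
      (simp add: group_face_cls[OF coset_tuples_subset[OF ts(1)]] group_chains_def)
qed

lemma group_chain_complex: "chain_complex (group_chains G H) (group_boundary G)"
proof -
  have sq: "frag_extend (\<lambda>w. \<Sum>i<Suc (Suc m). frag_cmul ((-1) ^ i) (group_face i w))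
      (\<Sum>i<Suc (Suc (Suc m)). frag_cmul ((-1) ^ i) (group_face i w)) = 0"
    if w: "w \<in> orbits G (coset_tuples G H (Suc (Suc m))) (diag_act G)" for m w
  proof (rule alternating_faces_square)
    fix i j :: nat
    assume ij: "i < j" "j \<le> Suc (Suc m)"
    obtain ts where ts: "ts \<in> coset_tuples G H (Suc (Suc m))" "w = cls ts"
      using w by (auto simp: orbits_def)
    have sub: "set ts \<subseteq> lcosets H" "set (delete_nth k ts) \<subseteq> lcosets H" for k
      using coset_tuples_subset[OF ts(1)] set_delete_nth[of k ts] by auto
    show "frag_extend (group_face i) (group_face j w) = frag_extend (group_face (j - 1)) (group_face i w)"
      using delete_nth_delete_nth[of i j ts] ij ts
      by (simp add: group_face_cls sub coset_tuples_def)
  qed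
  have "chain_complex (\<lambda>m. free_Abelian_group (orbits G (coset_tuples G H m) (diag_act G)))
      (\<lambda>m. frag_extend (\<lambda>w. \<Sum>i<Suc m. frag_cmul ((-1) ^ i) (group_face i w)))"
    using group_boundary_closed sq
    by (intro chain_complex_free) (simp_all only: group_chains_def)
  then show ?thesis
    by (simp only: group_boundary_eq[abs_def] group_chains_def[abs_def])
qed

lemma group_degenerate_subgroup: "subgroup (group_degenerate G H m) (group_chains G H m)"
  unfolding group_degenerate_def group_chains_def
  by (intro group.generate_is_subgroup) (auto simp: orbits_def)

lemma group_degenerateI:
  "ts \<in> coset_tuples G H m \<Longrightarrow> i < m \<Longrightarrow> ts ! i = ts ! Suc i \<Longrightarrow> frag_of (cls ts) \<in> group_degenerate G H m"
  unfolding group_degenerate_def by (rule generate.incl) auto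

lemma group_boundary_degenerate:
  "group_boundary G (Suc m) ` group_degenerate G H (Suc m) \<subseteq> group_degenerate G H m"
  unfolding group_boundary_eq group_degenerate_def[of _ _ "Suc m"] group_chains_def
proof (rule frag_extend_image_generate)
  show "subgroup (group_degenerate G H m)
      (free_Abelian_group (orbits G (coset_tuples G H m) (diag_act G)))"
    using group_degenerate_subgroup by (simp add: group_chains_def)
  fix c
  assume "c \<in> {frag_of (cls ts) |ts. ts \<in> coset_tuples G H (Suc m) \<and> (\<exists>i<Suc m. ts ! i = ts ! Suc i)}"
  then obtain ts k where ts: "c = frag_of (cls ts)" "ts \<in> coset_tuples G H (Suc m)"
    and k: "k < Suc m" "ts ! k = ts ! Suc k"
    by auto
  have len: "length ts = Suc (Suc m)"
    using ts by (simp add: coset_tuples_def)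
  note face = group_face_cls[OF coset_tuples_subset[OF ts(2)]]
  have "(\<Sum>i<Suc (Suc m). frag_cmul ((-1) ^ i) (group_face i (cls ts))) \<in> group_degenerate G H m"
  proof (rule alternating_sum_degenerate[OF group_degenerate_subgroup[unfolded group_chains_def]])
    show "Suc k < Suc (Suc m)"
      using k by simp
    \<comment> \<open>Deleting either of two equal neighbours leaves the same tuple.\<close>
    have "delete_nth k ts = delete_nth (Suc k) ts"
      using k len by (intro nth_equalityI)
        (auto simp: length_delete_nth nth_delete_nth less_Suc_eq[of _ k])
    then show "group_face k (cls ts) = group_face (Suc k) (cls ts)"
      by (simp add: face)
    fix i
    assume i: "i < Suc (Suc m)" "i \<noteq> k" "i \<noteq> Suc k"
    \<comment> \<open>The position of the equal pair after the deletion: it moves down by one if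
      entry \<open>i\<close> stood before it.\<close>
    define l where "l = (if i < k then k - 1 else k)"
    have "delete_nth i ts ! l = ts ! k" "delete_nth i ts ! Suc l = ts ! Suc k"
      using i k(1) len by (cases k; auto simp: nth_delete_nth l_def)+
    then have "delete_nth i ts ! l = delete_nth i ts ! Suc l"
      using k(2) by simp
    moreover have "l < m"
      using i k(1) by (auto simp: l_def)
    ultimately show "group_face i (cls ts) \<in> group_degenerate G H m"
      unfolding face by (intro group_degenerateI delete_nth_coset_tuples ts(2) i(1))
  qed
  then show "frag_extend (\<lambda>w. \<Sum>i<Suc (Suc m). frag_cmul ((-1) ^ i) (group_face i w)) c
      \<in> group_degenerate G H m"
    by (simp add: ts(1))
qed (use group_boundary_closed in \<open>auto simp: group_chains_def orbits_def\<close>)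

subsection \<open>Rack chains\<close>

text \<open>Both kinds of rack faces in one formula, with \<open>i\<close> counted from 0:
  \<open>e = 0\<close> is plain deletion, \<open>e = 1\<close> also translates the earlier entries.
  The exponent is later matched with a bit of \<open>\<iota>\<close>.\<close>

definition list_face :: "nat \<Rightarrow> nat \<Rightarrow> 'a set list \<Rightarrow> 'a set list" where
  "list_face e i xs = map (S (xs ! i) ^^ e) (take i xs) @ drop (Suc i) xs"

lemma length_list_face: "i < length xs \<Longrightarrow> length (list_face e i xs) = length xs - 1"
  by (simp add: list_face_def)

lemma nth_list_face:
  "i < length xs \<Longrightarrow> k < length xs - 1 \<Longrightarrow>
    list_face e i xs ! k = (if k < i then (S (xs ! i) ^^ e) (xs ! k) else xs ! Suc k)"
  by (auto simp: list_face_def nth_append)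

lemma nth_rcosets: "set xs \<subseteq> Q \<Longrightarrow> i < length xs \<Longrightarrow> xs ! i \<in> Q"
  using nth_mem by blast

lemma set_list_face: "set xs \<subseteq> Q \<Longrightarrow> i < length xs \<Longrightarrow> set (list_face e i xs) \<subseteq> Q"
  using set_take_subset[of i xs] set_drop_subset[of "Suc i" xs] nth_rcosets[of xs i]
  by (auto simp: list_face_def intro!: gaq_S_pow_closed)

text \<open>The presimplicial identity for arbitrary exponents; only entries before both positions
  are subject to two translations, and there it is self-distributivity.\<close>

lemma list_face_list_face:
  assumes "set xs \<subseteq> Q" "i < j" "j < length xs"
  shows "list_face a i (list_face b j xs) = list_face b (j - 1) (list_face a i xs)"
proof (rule nth_equalityI)
  show "length (list_face a i (list_face b j xs)) = length (list_face b (j - 1) (list_face a i xs))"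
    using assms by (simp add: length_list_face)
  fix k assume "k < length (list_face a i (list_face b j xs))"
  then have k: "k < length xs - 2"
    using assms by (simp add: length_list_face)
  \<comment> \<open>Since \<open>i < j\<close>, the entry at \<open>i\<close> has already been
    translated when it is used for the second face.\<close>
  have "list_face a i (list_face b j xs) ! k =
      (if k < i then (S ((S (xs ! j) ^^ b) (xs ! i)) ^^ a) ((S (xs ! j) ^^ b) (xs ! k))
       else list_face b j xs ! Suc k)"
    using assms k by (simp add: nth_list_face length_list_face)
  also have "\<dots> = (if k < i then (S (xs ! j) ^^ b) ((S (xs ! i) ^^ a) (xs ! k))
      else list_face b j xs ! Suc k)"
    using assms k by (simp add: gaq_S_pow_distrib nth_rcosets)
  also have "\<dots> = list_face b (j - 1) (list_face a i xs) ! k"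
    using assms k by (auto simp: nth_list_face length_list_face)
  finally show "list_face a i (list_face b j xs) ! k = list_face b (j - 1) (list_face a i xs) ! k" .
qed

text \<open>The signs of \<open>rack_boundary\<close> start at \<open>i = 1\<close>. Counting from 0
  flips them, hence the translated face is the positive term.\<close>

definition rack_face :: "nat \<Rightarrow> int \<times> 'a set list \<Rightarrow> (int \<times> 'a set list) \<Rightarrow>\<^sub>0 int" where
  "rack_face i = (\<lambda>(u, xs). frag_of (u + 1, list_face 1 i xs) - frag_of (u, list_face 0 i xs))"

lemma rack_boundary_eq:
  "rack_boundary G H \<phi> m = frag_extend (\<lambda>x. \<Sum>i<m. frag_cmul ((-1) ^ i) (rack_face i x))"
  unfolding rack_boundary_def
  by (rule arg_cong[where f = frag_extend], rule ext)
    (simp add: split_beta sum.atLeast1_atMost_eq rack_face_def list_face_def delete_nth_def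
      frag_cmul_diff sum_subtractf sum_negf flip: minus_frag_cmul)

lemma list_face_gens:
  "(u, xs) \<in> rack_gens G H (Suc m) \<Longrightarrow> i < Suc m \<Longrightarrow> (v, list_face e i xs) \<in> rack_gens G H m"
  using set_list_face[of xs i e] by (auto simp: rack_gens_def length_list_face)

lemma rack_face_closed:
  assumes "x \<in> rack_gens G H (Suc m)" "i < Suc m"
  shows "rack_face i x \<in> carrier (free_Abelian_group (rack_gens G H m))"
proof -
  obtain u xs where "x = (u, xs)" by fastforce
  with list_face_gens[of u xs m i] assms show ?thesis
    using keys_diff[of "frag_of (u + 1, list_face 1 i xs)" "frag_of (u, list_face 0 i xs)"]
    by (auto simp: rack_face_def)
qed

lemma rack_boundary_closed:
  "x \<in> rack_gens G H (Suc m) \<Longrightarrow>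
    (\<Sum>i<Suc m. frag_cmul ((-1) ^ i) (rack_face i x)) \<in> carrier (free_Abelian_group (rack_gens G H m))"
  by (intro sum_closed_free_Abelian_group cmul_carrier_free rack_face_closed) auto

text \<open>The face identity holds separately for all four combinations of exponents; the integer
  component increases by their sum in either order.\<close>

lemma rack_chain_complex: "chain_complex (rack_chains G H) (rack_boundary G H \<phi>)"
proof -
  have "frag_extend (\<lambda>x. \<Sum>i<Suc m. frag_cmul ((-1) ^ i) (rack_face i x))
      (\<Sum>i<Suc (Suc m). frag_cmul ((-1) ^ i) (rack_face i x)) = 0"
    if x: "x \<in> rack_gens G H (Suc (Suc m))" for m x
  proof (rule alternating_faces_square)
    fix i j :: nat
    assume ij: "i < j" "j \<le> Suc m"
    obtain u xs where "x = (u, xs)" "set xs \<subseteq> Q" "length xs = Suc (Suc m)"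
      using x by (auto simp: rack_gens_def)
    then show "frag_extend (rack_face i) (rack_face j x) = frag_extend (rack_face (j - 1)) (rack_face i x)"
      using ij by (simp add: rack_face_def frag_extend_diff list_face_list_face)
  qed
  then have "chain_complex (\<lambda>m. free_Abelian_group (rack_gens G H m))
      (\<lambda>m. frag_extend (\<lambda>x. \<Sum>i<m. frag_cmul ((-1) ^ i) (rack_face i x)))"
    using rack_boundary_closed by (intro chain_complex_free)
  then show ?thesis
    by (simp only: rack_boundary_eq[abs_def] rack_chains_def[abs_def])
qed

lemma rack_degenerate_subgroup: "subgroup (rack_degenerate G H m) (rack_chains G H m)"
  unfolding rack_degenerate_def rack_chains_def
  by (intro group.generate_is_subgroup) auto

lemma rack_degenerateI:
  "(u, xs) \<in> rack_gens G H m \<Longrightarrow> Suc i < m \<Longrightarrow> xs ! i = xs ! Suc i \<Longrightarrow>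
    frag_of (u, xs) \<in> rack_degenerate G H m"
  unfolding rack_degenerate_def
  by (rule generate.incl) (force intro!: exI[of _ "Suc i"])

text \<open>Passes from positions counted from 1 to list positions counted from 0.\<close>

lemma rack_degenerate_genE:
  assumes "c \<in> {frag_of (u, xs) |u xs. (u, xs) \<in> rack_gens G H m \<and>
      (\<exists>i. 1 \<le> i \<and> i \<le> m - 1 \<and> xs ! (i - 1) = xs ! i)}"
  obtains u xs k where "c = frag_of (u, xs)" "(u, xs) \<in> rack_gens G H m"
    "Suc k < m" "xs ! k = xs ! Suc k"
proof -
  obtain u xs i where "c = frag_of (u, xs)" "(u, xs) \<in> rack_gens G H m"
    "1 \<le> i" "i \<le> m - 1" "xs ! (i - 1) = xs ! i"
    using assms by auto
  then show ?thesis
    by (intro that[of u xs "i - 1"]) auto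
qed

lemma rack_boundary_degenerate:
  "rack_boundary G H \<phi> (Suc m) ` rack_degenerate G H (Suc m) \<subseteq> rack_degenerate G H m"
  unfolding rack_boundary_eq rack_degenerate_def[of _ _ "Suc m"] rack_chains_def
proof (rule frag_extend_image_generate)
  show N: "subgroup (rack_degenerate G H m) (free_Abelian_group (rack_gens G H m))"
    using rack_degenerate_subgroup by (simp add: rack_chains_def)
  fix c
  assume "c \<in> {frag_of (u, xs) |u xs. (u, xs) \<in> rack_gens G H (Suc m) \<and>
      (\<exists>i. 1 \<le> i \<and> i \<le> Suc m - 1 \<and> xs ! (i - 1) = xs ! i)}"
  then obtain u xs k where xs: "c = frag_of (u, xs)" "(u, xs) \<in> rack_gens G H (Suc m)"
    and k: "Suc k < Suc m" "xs ! k = xs ! Suc k"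
    by (rule rack_degenerate_genE)
  have len: "length xs = Suc m" and Q: "set xs \<subseteq> Q"
    using xs by (auto simp: rack_gens_def)
  have "(\<Sum>i<Suc m. frag_cmul ((-1) ^ i) (rack_face i (u, xs))) \<in> rack_degenerate G H m"
  proof (rule alternating_sum_degenerate[OF N k(1)])
    define A where "A = xs ! k"
    have A: "xs ! k = A" "xs ! Suc k = A" "A \<in> Q"
      using nth_rcosets[OF Q] k len by (simp_all add: A_def)
    \<comment> \<open>The two faces could differ only at \<open>j = k\<close>, where one has
      \<open>A\<close> and the other a translate of \<open>A\<close> by itself; idempotency makes
      them equal.\<close>
    have "list_face e k xs ! j = list_face e (Suc k) xs ! j" if "j < m" for e j
      using that k(1) len A
      by (cases j k rule: linorder_cases) (simp_all add: nth_list_face gaq_S_pow_idem)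
    then have "list_face e k xs = list_face e (Suc k) xs" for e
      using k(1) len by (intro nth_equalityI) (simp_all add: length_list_face)
    then show "rack_face k (u, xs) = rack_face (Suc k) (u, xs)"
      by (simp add: rack_face_def)
    fix i
    assume i: "i < Suc m" "i \<noteq> k" "i \<noteq> Suc k"
    \<comment> \<open>Again the new position of the equal pair. If \<open>i\<close> lies beyond it,
      both entries undergo the same translation and stay equal.\<close>
    define l where "l = (if i < k then k - 1 else k)"
    have "list_face e i xs ! l = list_face e i xs ! Suc l" for e
    proof (cases "i < k")
      case True
      then have "list_face e i xs ! l = xs ! k" "list_face e i xs ! Suc l = xs ! Suc k"
        using k(1) len by (cases k; auto simp: nth_list_face l_def)+
      then show ?thesis using k(2) by simp
    next
      case False
      then have "list_face e i xs ! l = (S (xs ! i) ^^ e) (xs ! k)"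
        "list_face e i xs ! Suc l = (S (xs ! i) ^^ e) (xs ! Suc k)"
        using k(1) i len by (auto simp: nth_list_face l_def)
      then show ?thesis using k(2) by simp
    qed
    moreover have "Suc l < m"
      using i k(1) by (auto simp: l_def)
    ultimately show "rack_face i (u, xs) \<in> rack_degenerate G H m"
      unfolding rack_face_def
      by (auto intro!: free_subgroup_diff[OF N] rack_degenerateI[where i = l]
          list_face_gens[OF xs(2) i(1)])
  qed
  then show "frag_extend (\<lambda>x. \<Sum>i<Suc m. frag_cmul ((-1) ^ i) (rack_face i x)) c
      \<in> rack_degenerate G H m"
    by (simp add: xs(1))
qed (use rack_boundary_closed in auto)

end

subsection \<open>The index set of psi\<close>

text \<open>The coface map missing \<open>i\<close>: it takes a position after the deletion to the
  position before it.\<close>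

definition skip :: "nat \<Rightarrow> nat \<Rightarrow> nat" where
  "skip i j = (if j < i then j else Suc j)"

text \<open>Indices in \<open>psi_index\<close> start at 2, and position 2 only acts on \<open>x\<^sub>1\<close>;
  this is why the removal of \<open>x\<^sub>1\<close> frees position 2.\<close>

definition insert_bit :: "nat \<Rightarrow> nat \<Rightarrow> nat \<Rightarrow> (nat \<Rightarrow> nat) \<Rightarrow> nat \<Rightarrow> nat" where
  "insert_bit m i b \<iota> =
     (\<lambda>j\<in>{2..Suc m}. if j = max 2 i then b else \<iota> (if j < i then j else j - 1))"

lemma insert_bit_max: "1 \<le> m \<Longrightarrow> i \<le> Suc m \<Longrightarrow> insert_bit m i b \<iota> (max 2 i) = b"
  by (simp add: insert_bit_def)

lemma insert_bit_skip: "1 \<le> i \<Longrightarrow> j \<in> {2..m} \<Longrightarrow> insert_bit m i b \<iota> (skip i j) = \<iota> j"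
  by (auto simp: insert_bit_def skip_def max_def)

text \<open>For \<open>i \<ge> 2\<close> the missed position is \<open>i\<close>; for
  \<open>i = 1\<close> all of \<open>{2..m}\<close> is shifted up, so 2 is missed.\<close>

lemma skip_range:
  "1 \<le> m \<Longrightarrow> 1 \<le> i \<Longrightarrow> i \<le> Suc m \<Longrightarrow> {2..Suc m} = insert (max 2 i) (skip i ` {2..m})"
proof (intro equalityI subsetI)
  fix j assume *: "1 \<le> m" "1 \<le> i" "i \<le> Suc m" "j \<in> {2..Suc m}"
  \<comment> \<open>The only candidate for a preimage of \<open>j\<close> under
    \<open>skip i\<close>.\<close>
  define k where "k = (if j < i then j else j - 1)"
  have "j = skip i k \<and> k \<in> {2..m}" if "j \<noteq> max 2 i"
    using * that by (auto simp: skip_def k_def max_def split: if_splits)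
  then show "j \<in> insert (max 2 i) (skip i ` {2..m})"
    by blast
qed (auto simp: skip_def max_def split: if_splits)

lemma skip_neq_max: "1 \<le> i \<Longrightarrow> 2 \<le> j \<Longrightarrow> skip i j \<noteq> max 2 i"
  by (auto simp: skip_def max_def)

lemma inj_skip: "inj (skip i)"
  by (rule injI) (auto simp: skip_def split: if_splits)

lemma finite_psi_index: "finite (psi_index m)"
  by (auto simp: psi_index_def intro!: finite_PiE)

lemma insert_bit_index:
  assumes "1 \<le> m" "1 \<le> i" "i \<le> Suc m" "\<iota> \<in> psi_index m" "b \<in> {0, 1}"
  shows "insert_bit m i b \<iota> \<in> psi_index (Suc m)"
  unfolding psi_index_def
proof (rule PiE_I)
  fix j assume "j \<in> {2..Suc m}"
  then consider "j = max 2 i" | k where "k \<in> {2..m}" "j = skip i k"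
    using skip_range[OF assms(1-3)] by blast
  then show "insert_bit m i b \<iota> j \<in> {0, 1}"
  proof cases
    case 1
    show ?thesis
      unfolding 1 insert_bit_max[OF assms(1,3)] by (rule assms(5))
  next
    case 2
    show ?thesis
      unfolding 2(2) insert_bit_skip[OF assms(2) 2(1)]
      using assms(4) 2(1) unfolding psi_index_def by (rule PiE_mem)
  qed
qed (auto simp: insert_bit_def)

text \<open>\<open>insert_bit\<close> is bijective: its inverse reads the bit at
  \<open>max 2 i\<close> and restricts along \<open>skip i\<close>. Degree \<open>m = 0\<close> is
  excluded because \<open>psi_index 0\<close> and \<open>psi_index 1\<close> both have one
  element.\<close>

lemma sum_psi_index_Suc:
  assumes "1 \<le> m" "1 \<le> i" "i \<le> Suc m"
  shows "sum F (psi_index (Suc m)) =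
    (\<Sum>\<iota>\<in>psi_index m. F (insert_bit m i 0 \<iota>) + F (insert_bit m i 1 \<iota>))"
proof -
  let ?r = "\<lambda>\<iota>. restrict (\<iota> \<circ> skip i) {2..m}"
  have inv: "insert_bit m i (\<iota> (max 2 i)) (?r \<iota>) = \<iota>" if \<iota>: "\<iota> \<in> psi_index (Suc m)" for \<iota>
  proof
    fix j
    show "insert_bit m i (\<iota> (max 2 i)) (?r \<iota>) j = \<iota> j"
    proof (cases "j \<in> {2..Suc m}")
      case True
      then consider "j = max 2 i" | k where "k \<in> {2..m}" "j = skip i k"
        using skip_range[OF assms] by blast
      then show ?thesis
      proof cases
        case 1
        show ?thesis
          unfolding 1 by (rule insert_bit_max[OF assms(1,3)])
      next
        case 2
        then show ?thesis
          by (simp add: insert_bit_skip[OF assms(2)])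
      qed
    next
      case False
      then show ?thesis
        using \<iota> by (auto simp: insert_bit_def psi_index_def PiE_def extensional_def)
    qed
  qed
  have "sum F (psi_index (Suc m)) =
      (\<Sum>(\<iota>, b)\<in>psi_index m \<times> {0, 1}. F (insert_bit m i b \<iota>))"
  proof (rule sum.reindex_bij_witness[where i = "\<lambda>(\<iota>, b). insert_bit m i b \<iota>"
        and j = "\<lambda>\<iota>. (?r \<iota>, \<iota> (max 2 i))"])
    fix \<iota> assume \<iota>: "\<iota> \<in> psi_index (Suc m)"
    then have range: "\<iota> j \<in> {0, 1}" if "j \<in> {2..Suc m}" for j
      using that by (auto simp: psi_index_def PiE_def Pi_def)
    show "(case (?r \<iota>, \<iota> (max 2 i)) of (\<iota>, b) \<Rightarrow> insert_bit m i b \<iota>) = \<iota>"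
      using inv[OF \<iota>] by simp
    show "(?r \<iota>, \<iota> (max 2 i)) \<in> psi_index m \<times> {0, 1}"
      using range skip_range[OF assms] unfolding psi_index_def mem_Times_iff fst_conv snd_conv
      by (intro conjI restrict_PiE_iff[THEN iffD2]) simp_all
    show "(case (?r \<iota>, \<iota> (max 2 i)) of (\<iota>, b) \<Rightarrow> F (insert_bit m i b \<iota>)) = F \<iota>"
      using inv[OF \<iota>] by simp
  next
    fix p assume p: "p \<in> psi_index m \<times> {0, 1::nat}"
    then obtain \<iota> b where \<iota>: "p = (\<iota>, b)" "\<iota> \<in> psi_index m" "b \<in> {0, 1}"
      by auto
    then have "?r (insert_bit m i b \<iota>) = \<iota>"
      using assms by (intro ext)
        (auto simp: insert_bit_skip psi_index_def PiE_def extensional_def restrict_def)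
    then show "(?r (case p of (\<iota>, b) \<Rightarrow> insert_bit m i b \<iota>),
        (case p of (\<iota>, b) \<Rightarrow> insert_bit m i b \<iota>) (max 2 i)) = p"
      using assms \<iota> by (simp add: insert_bit_max)
    show "(case p of (\<iota>, b) \<Rightarrow> insert_bit m i b \<iota>) \<in> psi_index (Suc m)"
      using insert_bit_index[OF assms \<iota>(2,3)] \<iota>(1) by simp
  qed
  then show ?thesis
    by (simp add: sum.distrib flip: sum.cartesian_product)
qed

lemma ones_insert_bit:
  assumes "1 \<le> m" "1 \<le> i" "i \<le> Suc m" "b \<in> {0, 1}"
  shows "ones (Suc m) (insert_bit m i b \<iota>) = ones m \<iota> + b"
proof -
  have "{j \<in> {2..Suc m}. insert_bit m i b \<iota> j = 1} =
      (if b = 1 then {max 2 i} else {}) \<union> skip i ` {j \<in> {2..m}. \<iota> j = 1}"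
    unfolding skip_range[OF assms(1-3)] using assms by (auto simp: insert_bit_max insert_bit_skip)
  also have "card \<dots> = (if b = 1 then 1 else 0) + card (skip i ` {j \<in> {2..m}. \<iota> j = 1})"
    using skip_neq_max[OF assms(2)] by (subst card_Un_disjoint) force+
  also have "\<dots> = ones m \<iota> + b"
    using assms(4) by (auto simp: ones_def card_image[OF inj_on_subset[OF inj_skip subset_UNIV]])
  finally show ?thesis
    by (simp add: ones_def)
qed

subsection \<open>The map psi\<close>

context alexander_quandle
begin

abbreviation "iter m xs \<iota> k \<equiv> iter_coset G H \<phi> m xs \<iota> k"

lemma iter_coset_closed:
  assumes "set xs \<subseteq> Q" "length xs = m" "1 \<le> k" "k \<le> m"
  shows "iter m xs \<iota> k \<in> Q"
proof -
  \<comment> \<open>Stated for any list of indices and any starting coset, to make the induction go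
    through.\<close>
  have "fold (\<lambda>j. S (xs ! (j - 1)) ^^ \<iota> j) js A \<in> Q" if "set js \<subseteq> {1..m}" "A \<in> Q" for js A
    using that assms
  proof (induction js arbitrary: A)
    case (Cons j js)
    then have "xs ! (j - 1) \<in> Q"
      by (auto intro!: nth_rcosets)
    with Cons show ?case
      by (simp add: gaq_S_pow_closed)
  qed simp
  moreover have "set [Suc k..<Suc m] \<subseteq> {1..m}"
    by auto
  ultimately show ?thesis
    unfolding iter_coset_def using assms by (simp add: nth_rcosets del: upt_Suc set_upt)
qed

text \<open>From position \<open>i\<close> on, deletion only renumbers the later translations.
  Before \<open>i\<close>, the face applies the translation by entry \<open>i\<close> to the start
  and to the translating entries alike, and self-distributivity pulls it out to its original place.
  For \<open>i = 1\<close> there is no earlier entry, so \<open>e\<close> is free.\<close>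

lemma iter_coset_face:
  assumes xs: "set xs \<subseteq> Q" "length xs = Suc m" and i: "1 \<le> i" "i \<le> Suc m"
    and k: "1 \<le> k" "k \<le> m" and e: "i = 1 \<or> e = \<iota> i"
    and \<iota>': "\<And>j. j \<in> {2..m} \<Longrightarrow> \<iota>' j = \<iota> (skip i j)"
  shows "iter m (list_face e (i - 1) xs) \<iota>' k = iter (Suc m) xs \<iota> (skip i k)"
proof (cases "k < i")
  case False
  let ?ys = "list_face e (i - 1) xs"
  have nth: "?ys ! (j - 1) = xs ! j" if "i \<le> j" "j \<le> m" for j
    using that i xs by (subst nth_list_face) auto
  have "[Suc (Suc k)..<Suc (Suc m)] = map Suc [Suc k..<Suc m]"
    by (simp only: map_Suc_upt)
  then have "iter (Suc m) xs \<iota> (skip i k) =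
      fold (\<lambda>j. S (xs ! j) ^^ \<iota> (Suc j)) [Suc k..<Suc m] (xs ! k)"
    using False by (simp only: iter_coset_def skip_def if_False fold_map o_def diff_Suc_1)
  also have "\<dots> = iter m ?ys \<iota>' k"
    unfolding iter_coset_def using False i k
    by (intro fold_cong) (auto simp: nth \<iota>' skip_def simp del: One_nat_def)
  finally show ?thesis ..
next
  case True
  let ?ys = "list_face e (i - 1) xs"
  define f where "f = S (xs ! (i - 1)) ^^ \<iota> i"
  have x_i: "xs ! (i - 1) \<in> Q"
    using xs i by (simp add: nth_rcosets)
  \<comment> \<open>Here \<open>1 \<le> k < i\<close> rules out \<open>i = 1\<close>, so
    \<open>e\<close> is the bit \<open>\<iota> i\<close>.\<close>
  have f: "S (xs ! (i - 1)) ^^ e = f"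
    using True k e by (auto simp: f_def)
  have nth1: "?ys ! (j - 1) = f (xs ! (j - 1))" if "1 \<le> j" "j < i" for j
    using that i xs by (subst nth_list_face) (auto simp: f[simplified])
  have nth2: "?ys ! (j - 1) = xs ! j" if "i \<le> j" "j \<le> m" for j
    using that i xs by (subst nth_list_face) auto
  \<comment> \<open>Pulls \<open>f\<close> out past all translations with index below
    \<open>i\<close>.\<close>
  have inner: "fold (\<lambda>j. S (?ys ! (j - 1)) ^^ \<iota>' j) js (f A) =
      f (fold (\<lambda>j. S (xs ! (j - 1)) ^^ \<iota> j) js A)"
    if "set js \<subseteq> {2..<i}" "A \<in> Q" for js A
    using that
  proof (induction js arbitrary: A)
    case (Cons j js)
    then have j: "2 \<le> j" "j < i" by auto
    then have x_j: "xs ! (j - 1) \<in> Q"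
      using xs i by (simp add: nth_rcosets)
    have "(S (?ys ! (j - 1)) ^^ \<iota>' j) (f A) = f ((S (xs ! (j - 1)) ^^ \<iota> j) A)"
      using j i x_j x_i Cons.prems(2) nth1[of j] \<iota>'[of j]
      by (simp add: skip_def f_def gaq_S_pow_distrib del: One_nat_def)
    then show ?case
      using Cons.IH[of "(S (xs ! (j - 1)) ^^ \<iota> j) A"] Cons.prems x_j
      by (simp add: gaq_S_pow_closed del: One_nat_def)
  qed simp
  have "iter m ?ys \<iota>' k = fold (\<lambda>j. S (?ys ! (j - 1)) ^^ \<iota>' j) [i..<Suc m]
      (fold (\<lambda>j. S (?ys ! (j - 1)) ^^ \<iota>' j) [Suc k..<i] (f (xs ! (k - 1))))"
    using True k i upt_add_eq_append[of "Suc k" i "Suc m - i"]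
    by (simp add: iter_coset_def nth1 del: upt_Suc One_nat_def)
  also have "\<dots> = fold (\<lambda>j. S (?ys ! (j - 1)) ^^ \<iota>' j) [i..<Suc m]
      (f (fold (\<lambda>j. S (xs ! (j - 1)) ^^ \<iota> j) [Suc k..<i] (xs ! (k - 1))))"
    using True k i xs by (subst inner) (auto simp: nth_rcosets)
  also have "\<dots> = fold (\<lambda>j. S (xs ! j) ^^ \<iota> (Suc j)) [i..<Suc m]
      (f (fold (\<lambda>j. S (xs ! (j - 1)) ^^ \<iota> j) [Suc k..<i] (xs ! (k - 1))))"
    using True k by (intro fold_cong) (auto simp: nth2 \<iota>' skip_def simp del: One_nat_def)
  also have "\<dots> = fold (\<lambda>j. S (xs ! (j - 1)) ^^ \<iota> j) (map Suc [i..<Suc m])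
      (f (fold (\<lambda>j. S (xs ! (j - 1)) ^^ \<iota> j) [Suc k..<i] (xs ! (k - 1))))"
    by (simp only: fold_map o_def diff_Suc_1)
  \<comment> \<open>\<open>f\<close> is precisely the factor with index \<open>i\<close> and fills
    the gap between the two ranges.\<close>
  also have "\<dots> = fold (\<lambda>j. S (xs ! (j - 1)) ^^ \<iota> j) ([Suc k..<i] @ i # [Suc i..<Suc (Suc m)])
      (xs ! (k - 1))"
    by (simp only: map_Suc_upt fold_append fold_Cons o_apply f_def)
  also have "[Suc k..<i] @ i # [Suc i..<Suc (Suc m)] = [Suc k..<Suc (Suc m)]"
    using True i upt_add_eq_append[of "Suc k" i "Suc (Suc m) - i"] upt_conv_Cons[of i "Suc (Suc m)"]
    by (simp del: upt_Suc)
  finally show ?thesis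
    using True by (simp add: iter_coset_def skip_def del: upt_Suc)
qed

section \<open>Tuples of left cosets modulo the diagonal action\<close>

abbreviation "aut_map u \<equiv> map (aut_pow_lcoset G H \<phi> u)"

lemma inv_coset_closed: "A \<in> Q \<Longrightarrow> inv_coset G H A \<in> lcosets H"
  by (elim rcosetE) (simp add: inv_coset_rcos lcos_in_lcosets)

lemma aut_pow_lcoset_closed: "A \<in> lcosets H \<Longrightarrow> aut_pow_lcoset G H \<phi> u A \<in> lcosets H"
  by (elim lcosetE) (simp add: aut_pow_lcos lcos_in_lcosets)

text \<open>Modulo the diagonal action, every translation \<open>S A\<close> acts on tuples as \<open>\<phi>\<close>. This makes the
  face of \<open>\<psi>\<close> that omits \<open>g\<^sup>-\<^sup>1H\<close> cancel in pairs.\<close>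

lemma tuple_class_gaq_S:
  assumes "A \<in> Q" "set L \<subseteq> Q"
  shows "cls (aut_map (u - 1) (map (\<lambda>B. inv_coset G H (S A B)) L)) =
    cls (aut_map u (map (inv_coset G H) L))"
proof -
  obtain k where k: "k \<in> carrier G" "A = H #> k"
    using assms(1) by (rule rcosetE)
  \<comment> \<open>Inverting \<open>\<phi> (x \<otimes> inv k) \<otimes> k\<close> gives
    \<open>inv k \<otimes> \<phi> k \<otimes> \<phi> (inv x)\<close>. The power \<open>u - 1\<close>
    turns the part without \<open>x\<close> into \<open>c\<close>, which is the same for all entries
    and so acts diagonally.\<close>
  define c where "c = aut_pow (u - 1) (inv k) \<otimes> aut_pow u k"
  have c: "c \<in> carrier G"
    using k by (simp add: c_def)
  have "aut_pow_lcoset G H \<phi> (u - 1) (inv_coset G H (S A B)) =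
      c <# aut_pow_lcoset G H \<phi> u (inv_coset G H B)" if "B \<in> Q" for B
  proof -
    obtain x where x: "x \<in> carrier G" "B = H #> x"
      using \<open>B \<in> Q\<close> by (rule rcosetE)
    have "inv (\<phi> (x \<otimes> inv k) \<otimes> k) = inv k \<otimes> \<phi> (k \<otimes> inv x)"
      using k x by (simp add: inv_mult_group flip: phi_inv)
    then have "aut_pow (u - 1) (inv (\<phi> (x \<otimes> inv k) \<otimes> k)) = c \<otimes> aut_pow u (inv x)"
      using k x by (simp add: aut_pow_mult aut_pow_phi c_def m_assoc)
    then show ?thesis
      using k x c subgroup.subset[OF sub]
      by (simp add: gaq_S_rcos inv_coset_rcos aut_pow_lcos lcos_m_assoc)
  qed
  then have "aut_map (u - 1) (map (\<lambda>B. inv_coset G H (S A B)) L) =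
      diag_act G c (aut_map u (map (inv_coset G H) L))"
    using assms(2) by (auto simp: diag_act_def)
  moreover have "set (aut_map u (map (inv_coset G H) L)) \<subseteq> lcosets H"
    using assms(2) by (auto intro!: aut_pow_lcoset_closed inv_coset_closed)
  ultimately show ?thesis
    using c by (simp add: tuple_class_diag_act)
qed

text \<open>\<open>G\<close> is transitive on left cosets, so the group complex has a single
  generator in degree 0.\<close>

lemma tuple_class_single:
  assumes "A \<in> lcosets H" "B \<in> lcosets H"
  shows "cls [A] = cls [B]"
proof -
  obtain a b where ab: "a \<in> carrier G" "A = a <# H" "b \<in> carrier G" "B = b <# H"
    using assms by (metis lcosetE)
  then have "diag_act G (b \<otimes> inv a) [A] = [B]"
    using subgroup.subset[OF sub] by (simp add: diag_act_def lcos_m_assoc m_assoc)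
  then show ?thesis
    using tuple_class_diag_act[of "b \<otimes> inv a" "[A]"] ab assms by simp
qed

section \<open>The tuples of psi and their faces\<close>

context
  fixes g assumes g: "g \<in> carrier G"
begin

text \<open>The base coset occupies position 0, so position \<open>k\<close> belongs to the
  \<open>k\<close>-th quandle element counted from 1.\<close>

definition psi_tuple :: "nat \<Rightarrow> 'a set list \<Rightarrow> (nat \<Rightarrow> nat) \<Rightarrow> 'a set list" where
  "psi_tuple m xs \<iota> = (inv g <# H) # map (\<lambda>k. inv_coset G H (iter m xs \<iota> k)) [1..<Suc m]"

lemma length_psi_tuple: "length (psi_tuple m xs \<iota>) = Suc m"
  by (simp add: psi_tuple_def)

lemma nth_psi_tuple:
  "1 \<le> k \<Longrightarrow> k \<le> m \<Longrightarrow> psi_tuple m xs \<iota> ! k = inv_coset G H (iter m xs \<iota> k)"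
  by (cases k) (simp_all add: psi_tuple_def del: upt_Suc)

lemma psi_gen_eq:
  "psi_gen G H \<phi> g m (u, xs) = (\<Sum>\<iota>\<in>psi_index m. frag_cmul ((-1) ^ (ones m \<iota> + 1))
     (frag_of (cls (aut_map (- int (ones m \<iota>) - u) (psi_tuple m xs \<iota>)))))"
  by (simp only: psi_gen_def psi_tuple_def split_conv)

lemma psi_tuple_closed:
  assumes "set xs \<subseteq> Q" "length xs = m"
  shows "aut_map u (psi_tuple m xs \<iota>) \<in> coset_tuples G H m"
  using assms g
  by (auto simp: coset_tuples_def psi_tuple_def lcos_in_lcosets intro!: aut_pow_lcoset_closed
      inv_coset_closed iter_coset_closed simp del: upt_Suc)

lemma psi_gen_closed:
  assumes "(u, xs) \<in> rack_gens G H m"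
  shows "psi_gen G H \<phi> g m (u, xs) \<in> carrier (group_chains G H m)"
  unfolding psi_gen_eq group_chains_def
  using assms frag_of_cls_carrier psi_tuple_closed
  by (intro sum_closed_free_Abelian_group cmul_carrier_free) (simp add: group_chains_def rack_gens_def)

lemma delete_psi_tuple:
  assumes xs: "set xs \<subseteq> Q" "length xs = Suc m" and i: "1 \<le> i" "i \<le> Suc m"
    and e: "i = 1 \<or> e = \<iota> i" and \<iota>': "\<And>j. j \<in> {2..m} \<Longrightarrow> \<iota>' j = \<iota> (skip i j)"
  shows "delete_nth i (psi_tuple (Suc m) xs \<iota>) = psi_tuple m (list_face e (i - 1) xs) \<iota>'"
proof (rule nth_equalityI)
  show len: "length (delete_nth i (psi_tuple (Suc m) xs \<iota>)) =
      length (psi_tuple m (list_face e (i - 1) xs) \<iota>')"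
    using i by (simp add: length_delete_nth length_psi_tuple)
  fix k assume "k < length (delete_nth i (psi_tuple (Suc m) xs \<iota>))"
  then have k: "k \<le> m"
    unfolding len by (simp add: length_psi_tuple)
  show "delete_nth i (psi_tuple (Suc m) xs \<iota>) ! k = psi_tuple m (list_face e (i - 1) xs) \<iota>' ! k"
  proof (cases "k = 0")
    case True
    then show ?thesis
      using i by (simp add: nth_delete_nth length_psi_tuple) (simp add: psi_tuple_def)
  next
    case False
    then have "delete_nth i (psi_tuple (Suc m) xs \<iota>) ! k = psi_tuple (Suc m) xs \<iota> ! skip i k"
      using k by (simp add: nth_delete_nth length_psi_tuple skip_def)
    also have "\<dots> = inv_coset G H (iter (Suc m) xs \<iota> (skip i k))"
      using k False by (intro nth_psi_tuple) (auto simp: skip_def)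
    also have "\<dots> = psi_tuple m (list_face e (i - 1) xs) \<iota>' ! k"
      using False k iter_coset_face[OF xs i _ k e \<iota>'] by (simp add: nth_psi_tuple)
    finally show ?thesis .
  qed
qed

text \<open>The sum is split by the bit at \<open>max 2 i\<close>. Bit 0 yields the deleted face.
  Bit 1 yields the translated face, its additional one flipping the sign and lowering the exponent,
  which amounts to replacing \<open>u\<close> by \<open>u + 1\<close>.\<close>

lemma psi_face:
  assumes xs: "set xs \<subseteq> Q" "length xs = Suc m" and i: "1 \<le> i" "i \<le> Suc m" and m: "1 \<le> m"
  shows "(\<Sum>\<iota>\<in>psi_index (Suc m). frag_cmul ((-1) ^ (ones (Suc m) \<iota> + 1)) (frag_of (cls
      (aut_map (- int (ones (Suc m) \<iota>) - u) (delete_nth i (psi_tuple (Suc m) xs \<iota>)))))) =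
    - frag_extend (psi_gen G H \<phi> g m) (rack_face (i - 1) (u, xs))"
proof -
  have del: "delete_nth i (psi_tuple (Suc m) xs (insert_bit m i b \<iota>)) =
      psi_tuple m (list_face b (i - 1) xs) \<iota>" for b \<iota>
  proof (rule delete_psi_tuple[OF xs i])
    \<comment> \<open>For \<open>i \<ge> 2\<close> the inserted bit sits at \<open>i\<close>
      itself.\<close>
    show "i = 1 \<or> b = insert_bit m i b \<iota> i"
      using insert_bit_max[OF m i(2), of b \<iota>] i(1) by (cases "i = 1") (auto simp: max_def)
  qed (use insert_bit_skip[OF i(1)] in simp)
  have ones: "ones (Suc m) (insert_bit m i 0 \<iota>) = ones m \<iota>"
    "ones (Suc m) (insert_bit m i 1 \<iota>) = ones m \<iota> + 1" for \<iota>
    by (simp_all add: ones_insert_bit[OF m i])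
  have shift: "- int (n + 1) - u = - int n - (u + 1)" for n
    by simp
  show ?thesis
    unfolding sum_psi_index_Suc[OF m i] ones shift del
    by (simp add: rack_face_def frag_extend_diff psi_gen_eq sum_subtractf sum_negf
        flip: minus_frag_cmul)
qed

lemma psi_face_0:
  assumes xs: "set xs \<subseteq> Q" "length xs = Suc m" and m: "1 \<le> m"
  shows "(\<Sum>\<iota>\<in>psi_index (Suc m). frag_cmul ((-1) ^ (ones (Suc m) \<iota> + 1)) (frag_of (cls
      (aut_map (- int (ones (Suc m) \<iota>) - u) (delete_nth 0 (psi_tuple (Suc m) xs \<iota>)))))) = 0"
proof -
  have A: "xs ! m \<in> Q"
    using xs by (simp add: nth_rcosets)
  \<comment> \<open>The entries before the last translation; the final one, \<open>xs ! m\<close>,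
    is fixed by its own translation and thus fits the same pattern.\<close>
  define L where "L \<iota> = map (iter m xs \<iota>) [1..<Suc m] @ [xs ! m]" for \<iota>
  have L: "set (L \<iota>) \<subseteq> Q" for \<iota>
  proof -
    \<comment> \<open>\<open>iter m\<close> reads only the first \<open>m\<close> entries, so
      closure is obtained from the truncated list.\<close>
    have "iter m xs \<iota> k = iter m (take m xs) \<iota> k" if "1 \<le> k" "k \<le> m" for k
      unfolding iter_coset_def using that by (intro fold_cong) auto
    then have "iter m xs \<iota> k \<in> Q" if "1 \<le> k" "k \<le> m" for k
      using that iter_coset_closed[of "take m xs" m k \<iota>] xs set_take_subset[of m xs] by simp
    then show ?thesis
      using A by (auto simp: L_def simp del: upt_Suc)
  qed
  have del: "delete_nth 0 (psi_tuple (Suc m) xs (insert_bit m (Suc m) b \<iota>)) =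
      map (\<lambda>B. inv_coset G H ((S (xs ! m) ^^ b) B)) (L \<iota>)" for b \<iota>
  proof -
    have b: "insert_bit m (Suc m) b \<iota> (Suc m) = b"
      using insert_bit_max[OF m, of "Suc m"] m by (simp add: max_def)
    have \<iota>: "insert_bit m (Suc m) b \<iota> j = \<iota> j" if "j \<in> {2..m}" for j
      using insert_bit_skip[of "Suc m" j m] that by (simp add: skip_def)
    have "iter (Suc m) xs (insert_bit m (Suc m) b \<iota>) k = (S (xs ! m) ^^ b) (iter m xs \<iota> k)"
      if "1 \<le> k" "k \<le> m" for k
    proof -
      have "fold (\<lambda>j. S (xs ! (j - 1)) ^^ insert_bit m (Suc m) b \<iota> j) [Suc k..<Suc m] (xs ! (k - 1)) =
          iter m xs \<iota> k"
        unfolding iter_coset_def using that by (intro fold_cong) (auto simp: \<iota>)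
      moreover have "[Suc k..<Suc (Suc m)] = [Suc k..<Suc m] @ [Suc m]"
        using that by simp
      ultimately show ?thesis
        by (simp add: iter_coset_def b del: upt_Suc)
    qed
    moreover have "iter (Suc m) xs (insert_bit m (Suc m) b \<iota>) (Suc m) = (S (xs ! m) ^^ b) (xs ! m)"
      using A by (simp add: iter_coset_def gaq_S_pow_idem)
    moreover have "[1..<Suc (Suc m)] = [1..<Suc m] @ [Suc m]"
      by simp
    ultimately show ?thesis
      by (simp add: delete_nth_def psi_tuple_def L_def del: upt_Suc)
  qed
  \<comment> \<open>Setting the last bit lowers the exponent by one and translates every entry,
    which leaves the class unchanged; the opposite signs then cancel.\<close>
  have "cls (aut_map (- int (ones m \<iota> + 1) - u) (map (\<lambda>B. inv_coset G H (S (xs ! m) B)) (L \<iota>))) =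
      cls (aut_map (- int (ones m \<iota>) - u) (map (inv_coset G H) (L \<iota>)))" for \<iota>
  proof -
    have "- int (ones m \<iota> + 1) - u = - int (ones m \<iota>) - u - 1"
      by simp
    then show ?thesis
      by (simp only: tuple_class_gaq_S[OF A L])
  qed
  then show ?thesis
    using m by (simp add: sum_psi_index_Suc[of m "Suc m"] ones_insert_bit[of m "Suc m"] del
        flip: frag_cmul_distrib)
qed

text \<open>Exchanging the sums groups the terms by omitted position: \<open>T 0\<close> vanishes
  for \<open>m \<ge> 1\<close>, and \<open>T (Suc i)\<close> matches rack face \<open>i\<close> up
  to sign.\<close>

lemma psi_boundary:
  assumes "(u, xs) \<in> rack_gens G H (Suc m)"
  shows "frag_extend (psi_gen G H \<phi> g m) (\<Sum>i<Suc m. frag_cmul ((-1) ^ i) (rack_face i (u, xs))) =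
    group_boundary G (Suc m) (psi_gen G H \<phi> g (Suc m) (u, xs))"
proof -
  have xs: "set xs \<subseteq> Q" "length xs = Suc m"
    using assms by (auto simp: rack_gens_def)
  have lcos: "aut_pow_lcoset G H \<phi> v (inv g <# H) \<in> lcosets H" for v
    using g by (intro aut_pow_lcoset_closed lcos_in_lcosets) simp
  define T where "T i = (\<Sum>\<iota>\<in>psi_index (Suc m). frag_cmul ((-1) ^ (ones (Suc m) \<iota> + 1)) (frag_of (cls
      (aut_map (- int (ones (Suc m) \<iota>) - u) (delete_nth i (psi_tuple (Suc m) xs \<iota>))))))" for i
  have "group_boundary G (Suc m) (psi_gen G H \<phi> g (Suc m) (u, xs)) =
      (\<Sum>\<iota>\<in>psi_index (Suc m). frag_cmul ((-1) ^ (ones (Suc m) \<iota> + 1))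
        (\<Sum>i<Suc (Suc m). frag_cmul ((-1) ^ i) (frag_of (cls
          (aut_map (- int (ones (Suc m) \<iota>) - u) (delete_nth i (psi_tuple (Suc m) xs \<iota>)))))))"
    unfolding group_boundary_eq psi_gen_eq frag_extend_sum[OF finite_psi_index] o_def
      frag_extend_cmul frag_extend_of
    by (simp only: group_face_cls[OF coset_tuples_subset[OF psi_tuple_closed[OF xs]]] delete_nth_map)
  also have "\<dots> = (\<Sum>i<Suc (Suc m). frag_cmul ((-1) ^ i) (T i))"
    unfolding T_def frag_cmul_sum frag_cmul_cmul
    by (subst sum.swap) (simp only: mult.commute)
  \<comment> \<open>The index shift produces a minus sign, which meets the one in
    \<open>psi_face\<close>.\<close>
  also have "\<dots> = T 0 - (\<Sum>i<Suc m. frag_cmul ((-1) ^ i) (T (Suc i)))"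
    by (subst sum.lessThan_Suc_shift) (simp add: sum_negf flip: minus_frag_cmul)
  also have "\<dots> = (\<Sum>i<Suc m. frag_cmul ((-1) ^ i) (frag_extend (psi_gen G H \<phi> g m) (rack_face i (u, xs))))"
  proof (cases "m = 0")
    case False
    then have "T 0 = 0"
      using psi_face_0[OF xs] by (simp add: T_def)
    moreover have "T (Suc i) = - frag_extend (psi_gen G H \<phi> g m) (rack_face i (u, xs))"
      if "i < Suc m" for i
      using psi_face[OF xs, of "Suc i"] that False by (simp add: T_def)
    ultimately show ?thesis
      by (simp add: frag_cmul_uminus del: sum.lessThan_Suc flip: sum_negf)
  next
    \<comment> \<open>There is no bit to pair here. Both sides vanish instead, since all one-entry
      tuples form one class.\<close>
    case True
    obtain A where A: "xs = [A]" "A \<in> Q"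
      using xs True by (auto simp: length_Suc_conv)
    have "T 0 = T 1"
      using True A g tuple_class_single[OF aut_pow_lcoset_closed[OF inv_coset_closed[OF A(2)]] lcos,
          of "- u" "- u"]
      by (simp add: T_def psi_index_def ones_def psi_tuple_def delete_nth_def iter_coset_def)
    moreover have "frag_extend (psi_gen G H \<phi> g 0) (rack_face 0 (u, xs)) = 0"
      using A tuple_class_single[OF lcos lcos, of "- u" "- 1 - u"]
      by (simp add: rack_face_def frag_extend_diff psi_gen_eq psi_index_def ones_def psi_tuple_def
          list_face_def algebra_simps)
    ultimately show ?thesis
      using True by simp
  qed
  also have "\<dots> = frag_extend (psi_gen G H \<phi> g m)
      (\<Sum>i<Suc m. frag_cmul ((-1) ^ i) (rack_face i (u, xs)))"
    by (simp only: frag_extend_sum finite_lessThan o_def frag_extend_cmul)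
  finally show ?thesis ..
qed

lemma psi_chain_map:
  "chain_map (rack_chains G H) (rack_boundary G H \<phi>) (group_chains G H) (group_boundary G)
    (psi G H \<phi> g)"
proof -
  have "chain_map (\<lambda>m. free_Abelian_group (rack_gens G H m))
      (\<lambda>m. frag_extend (\<lambda>x. \<Sum>i<m. frag_cmul ((-1) ^ i) (rack_face i x)))
      (\<lambda>m. free_Abelian_group (orbits G (coset_tuples G H m) (diag_act G)))
      (\<lambda>m. frag_extend (\<lambda>w. \<Sum>i<Suc m. frag_cmul ((-1) ^ i) (group_face i w)))
      (\<lambda>m. frag_extend (psi_gen G H \<phi> g m))"
  proof (rule chain_map_free)
    show "chain_complex (\<lambda>m. free_Abelian_group (rack_gens G H m))
        (\<lambda>m. frag_extend (\<lambda>x. \<Sum>i<m. frag_cmul ((-1) ^ i) (rack_face i x)))"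
      using rack_chain_complex by (simp only: rack_boundary_eq[abs_def] rack_chains_def[abs_def])
    show "chain_complex (\<lambda>m. free_Abelian_group (orbits G (coset_tuples G H m) (diag_act G)))
        (\<lambda>m. frag_extend (\<lambda>w. \<Sum>i<Suc m. frag_cmul ((-1) ^ i) (group_face i w)))"
      using group_chain_complex by (simp only: group_boundary_eq[abs_def] group_chains_def[abs_def])
  next
    fix m x
    show "psi_gen G H \<phi> g m x
        \<in> carrier (free_Abelian_group (orbits G (coset_tuples G H m) (diag_act G)))"
      if "x \<in> rack_gens G H m"
      using that psi_gen_closed by (cases x) (simp only: group_chains_def)
    show "frag_extend (psi_gen G H \<phi> g m) (\<Sum>i<Suc m. frag_cmul ((-1) ^ i) (rack_face i x)) =
        frag_extend (\<lambda>w. \<Sum>i<Suc (Suc m). frag_cmul ((-1) ^ i) (group_face i w))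
          (psi_gen G H \<phi> g (Suc m) x)"
      if "x \<in> rack_gens G H (Suc m)"
      using that psi_boundary by (cases x) (simp only: group_boundary_eq)
  qed
  then show ?thesis
    by (simp only: rack_boundary_eq[abs_def] rack_chains_def[abs_def] group_boundary_eq[abs_def]
        group_chains_def[abs_def] psi_def[abs_def])
qed

section \<open>Degenerate chains and degree zero under psi\<close>

lemma psi_degenerate: "psi G H \<phi> g m ` rack_degenerate G H m \<subseteq> group_degenerate G H m"
  unfolding psi_def rack_degenerate_def rack_chains_def
proof (rule frag_extend_image_generate)
  show N: "subgroup (group_degenerate G H m)
      (free_Abelian_group (orbits G (coset_tuples G H m) (diag_act G)))"
    using group_degenerate_subgroup by (simp add: group_chains_def)
  show "psi_gen G H \<phi> g m x
      \<in> carrier (free_Abelian_group (orbits G (coset_tuples G H m) (diag_act G)))"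
    if "x \<in> rack_gens G H m" for x
    using that psi_gen_closed by (cases x) (simp only: group_chains_def)
  fix c
  assume "c \<in> {frag_of (u, xs) |u xs. (u, xs) \<in> rack_gens G H m \<and>
      (\<exists>i. 1 \<le> i \<and> i \<le> m - 1 \<and> xs ! (i - 1) = xs ! i)}"
  then obtain u xs k where c: "c = frag_of (u, xs)" and gens: "(u, xs) \<in> rack_gens G H m"
    and k: "Suc k < m" "xs ! k = xs ! Suc k"
    by (rule rack_degenerate_genE)
  have xs: "set xs \<subseteq> Q" "length xs = m"
    using gens by (auto simp: rack_gens_def)
  \<comment> \<open>The base coset shifts the equal pair from \<open>k\<close>, \<open>Suc k\<close>
    in \<open>xs\<close> to \<open>Suc k\<close>, \<open>Suc (Suc k)\<close> in the tuple.\<close>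
  have "frag_of (cls (aut_map v (psi_tuple m xs \<iota>))) \<in> group_degenerate G H m" for v \<iota>
  proof (rule group_degenerateI[where i = "Suc k"])
    \<comment> \<open>Splits off the first translation of the earlier entry, which is by that same
      coset and fixes it; the remaining translations are shared.\<close>
    have "[Suc (Suc k)..<Suc m] = Suc (Suc k) # [Suc (Suc (Suc k))..<Suc m]"
      using k by (intro upt_conv_Cons) simp
    then have "iter m xs \<iota> (Suc k) = iter m xs \<iota> (Suc (Suc k))"
      using k nth_rcosets[OF xs(1), of "Suc k"] xs(2)
      by (simp add: iter_coset_def gaq_S_pow_idem del: upt_Suc)
    then show "aut_map v (psi_tuple m xs \<iota>) ! Suc k = aut_map v (psi_tuple m xs \<iota>) ! Suc (Suc k)"
      using k by (simp add: length_psi_tuple nth_psi_tuple)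
  qed (use psi_tuple_closed[OF xs] k in auto)
  then show "frag_extend (psi_gen G H \<phi> g m) c \<in> group_degenerate G H m"
    unfolding c frag_extend_of psi_gen_eq
    by (intro free_subgroup_sum[OF N] free_subgroup_cmul[OF N])
qed (auto simp: rack_chains_def)

lemma psi_degree_0: "psi G H \<phi> g 0 (frag_of (u, [])) = - frag_of (cls [H])"
  using tuple_class_single[OF aut_pow_lcoset_closed[OF lcos_in_lcosets] lcos_in_lcosets[of \<one>]]
    g lcos_mult_one[OF subgroup.subset[OF sub]]
  by (simp add: psi_0)

end

end

theorem theorem4p1:
  fixes G :: "('a, 'b) monoid_scheme" and H :: "'a set" and \<phi> :: "'a \<Rightarrow> 'a" and g :: 'a
  assumes "group G"
    and "\<phi> \<in> auto G"
    and "subgroup H G"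
    and "\<forall>h\<in>H. \<phi> h = h"
    and "g \<in> carrier G"
  shows "(\<forall>u. psi G H \<phi> g 0 (frag_of (u, [])) = - frag_of (tuple_class G [H])) \<and>
         chain_map (rack_chains G H) (rack_boundary G H \<phi>)
           (group_chains G H) (group_boundary G) (psi G H \<phi> g) \<and>
         (\<forall>m. psi G H \<phi> g m ` rack_degenerate G H m \<subseteq> group_degenerate G H m) \<and>
         chain_map (quandle_chains G H) (quandle_boundary G H \<phi>)
           (norm_group_chains G H) (norm_group_boundary G H) (psi_quotient G H \<phi> g)"
proof -
  interpret alexander_quandle G H \<phi>
    using assms by (intro alexander_quandle.intro alexander_quandle_axioms.intro) auto
  note g = assms(5)
  \<comment> \<open>The quotient statement is formal once degenerate chains are preserved by both
    boundaries and by \<open>psi\<close>.\<close>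
  have "chain_map (quandle_chains G H) (quandle_boundary G H \<phi>)
      (norm_group_chains G H) (norm_group_boundary G H) (psi_quotient G H \<phi> g)"
    unfolding quandle_chains_def[abs_def] quandle_boundary_def[abs_def] norm_group_chains_def[abs_def]
      norm_group_boundary_def[abs_def] psi_quotient_def[abs_def]
    by (rule chain_map_quotient[OF psi_chain_map[OF g] rack_degenerate_subgroup
          group_degenerate_subgroup rack_boundary_degenerate group_boundary_degenerate
          psi_degenerate[OF g]])
  then show ?thesis
    using psi_degree_0[OF g] psi_chain_map[OF g] psi_degenerate[OF g] by blast
qed

end
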